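(* Let $(X,\leq)$ be a poset and $K$ a field, and let $FI(X,K)$ be the finitary incidence algebra of $X$ over $K$. The following conditions are equivalent: (1) $FI(X,K)$ satisfies a polynomial identity; (2) $FI(X,K)$ is Lie solvable; (3) $FI(X,K)$ is strongly Lie solvable; (4) the group of units $\mathcal{U}(FI(X,K))$ satisfies a group identity; (5) $\mathcal{U}(FI(X,K))$ is solvable; (6) $X$ is bounded.
   Context: The finitary incidence algebra $FI(X,K)$ is the $K$-vector space of formal sums $\alpha=\sum_{x\leq y}\alpha_{xy}e_{xy}$ ($x,y\in X$, $\alpha_{xy}\in K$) such that for every pair $x<y$ there are only finitely many $x\leq u<v\leq y$ with $\alpha_{uv}\neq 0$; the product is the convolution $\alpha\beta=\sum_{x\leq y}\big(\sum_{x\leq z\leq y}\alpha_{xz}\beta_{zy}\big)e_{xy}$, with identity $\delta=\sum_{x\in X}e_{xx}$. For a unital associative algebra $A$, with $[x,y]=xy-yx$ and, for subspaces $U,V$, $UV$ and $[U,V]$ the spans of products and commutators: the Lie derived series is $A^{[0]}=A$, $A^{[n+1]}=[A^{[n]},A^{[n]}]$, and $A$ is Lie solvable if $A^{[n]}=\{0\}$ for some $n$; the series $A^{(0)}=A$, $A^{(n+1)}=[A^{(n)},A^{(n)}]A$ defines strong Lie solvability: $A$ is strongly Lie solvable if $A^{(n)}=\{0\}$ for some $n$. The length of a finite chain $C\subseteq X$ is $|C|-1$; the length $l(X)$ of $X$ is the supremum of lengths of finite chains in $X$; $X$ is bounded if $l(X)<\infty$. A group satisfies a group identity if some nontrivial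 word $w(x_1,\dots,x_n)$ in a free group satisfies $w(g_1,\dots,g_n)=1$ for all elements $g_i$ of the group. *)

theory Defs
  imports Main "HOL-Algebra.Solvable_Groups"
begin

text \<open>The poset is a subset X of a type with a partial order (every poset is of this
form). Elements of FI(X,K) are represented as functions alpha :: 'a => 'a => 'k,
alpha x y being the coefficient of e_xy; they vanish outside {(x,y). x,y in X, x <= y}.\<close>

definition fi_elem :: "'a::order set \<Rightarrow> ('a \<Rightarrow> 'a \<Rightarrow> 'k::field) \<Rightarrow> bool" where
  "fi_elem X \<alpha> \<longleftrightarrow>
     (\<forall>x y. \<alpha> x y \<noteq> 0 \<longrightarrow> x \<in> X \<and> y \<in> X \<and> x \<le> y) \<and>
     (\<forall>x\<in>X. \<forall>y\<in>X. x < y \<longrightarrow>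
        finite {(u, v). u \<in> X \<and> v \<in> X \<and> x \<le> u \<and> u < v \<and> v \<le> y \<and> \<alpha> u v \<noteq> 0})"

definition FI :: "'a::order set \<Rightarrow> ('a \<Rightarrow> 'a \<Rightarrow> 'k::field) set" where
  "FI X = {\<alpha>. fi_elem X \<alpha>}"

text \<open>Convolution product; the sum ranges over the (finite, for elements of FI) set of
z with nonzero summand, which equals the formal sum over the interval [x,y].\<close>
definition fi_mult :: "'a::order set \<Rightarrow> ('a \<Rightarrow> 'a \<Rightarrow> 'k::field) \<Rightarrow> ('a \<Rightarrow> 'a \<Rightarrow> 'k) \<Rightarrow> ('a \<Rightarrow> 'a \<Rightarrow> 'k)" where
  "fi_mult X \<alpha> \<beta> = (\<lambda>x y. if x \<in> X \<and> y \<in> X \<and> x \<le> y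
      then (\<Sum>z\<in>{z \<in> X. x \<le> z \<and> z \<le> y \<and> \<alpha> x z * \<beta> z y \<noteq> 0}. \<alpha> x z * \<beta> z y)
      else 0)"

definition fi_one :: "'a::order set \<Rightarrow> ('a \<Rightarrow> 'a \<Rightarrow> 'k::field)" where
  "fi_one X = (\<lambda>x y. if x \<in> X \<and> x = y then 1 else 0)"

definition fi_zero :: "'a \<Rightarrow> 'a \<Rightarrow> 'k::field" where
  "fi_zero = (\<lambda>x y. 0)"

definition fi_span :: "('a \<Rightarrow> 'a \<Rightarrow> 'k::field) set \<Rightarrow> ('a \<Rightarrow> 'a \<Rightarrow> 'k) set" where
  "fi_span S = {\<gamma>. \<exists>F c. finite F \<and> F \<subseteq> S \<and> \<gamma> = (\<lambda>x y. \<Sum>v\<in>F. c v * v x y)}"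

definition fi_commutator :: "'a::order set \<Rightarrow> ('a \<Rightarrow> 'a \<Rightarrow> 'k::field) \<Rightarrow> ('a \<Rightarrow> 'a \<Rightarrow> 'k) \<Rightarrow> ('a \<Rightarrow> 'a \<Rightarrow> 'k)" where
  "fi_commutator X \<alpha> \<beta> = (\<lambda>x y. fi_mult X \<alpha> \<beta> x y - fi_mult X \<beta> \<alpha> x y)"

definition fi_lie_bracket_space :: "'a::order set \<Rightarrow> ('a \<Rightarrow> 'a \<Rightarrow> 'k::field) set \<Rightarrow> ('a \<Rightarrow> 'a \<Rightarrow> 'k) set \<Rightarrow> ('a \<Rightarrow> 'a \<Rightarrow> 'k) set" where
  "fi_lie_bracket_space X U V = fi_span {fi_commutator X u v | u v. u \<in> U \<and> v \<in> V}"

definition fi_prod_space :: "'a::order set \<Rightarrow> ('a \<Rightarrow> 'a \<Rightarrow> 'k::field) set \<Rightarrow> ('a \<Rightarrow> 'a \<Rightarrow> 'k) set \<Rightarrow> ('a \<Rightarrow> 'a \<Rightarrow> 'k) set" where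
  "fi_prod_space X U V = fi_span {fi_mult X u v | u v. u \<in> U \<and> v \<in> V}"

fun lie_derived :: "'a::order set \<Rightarrow> nat \<Rightarrow> ('a \<Rightarrow> 'a \<Rightarrow> 'k::field) set" where
  "lie_derived X 0 = FI X"
| "lie_derived X (Suc n) = fi_lie_bracket_space X (lie_derived X n) (lie_derived X n)"

fun strong_lie_derived :: "'a::order set \<Rightarrow> nat \<Rightarrow> ('a \<Rightarrow> 'a \<Rightarrow> 'k::field) set" where
  "strong_lie_derived X 0 = FI X"
| "strong_lie_derived X (Suc n) =
     fi_prod_space X (fi_lie_bracket_space X (strong_lie_derived X n) (strong_lie_derived X n)) (FI X)"

definition FI_lie_solvable :: "'a::order set \<Rightarrow> 'k::field itself \<Rightarrow> bool" where
  "FI_lie_solvable X TYPE('k) \<longleftrightarrow> (\<exists>n. lie_derived X n = {fi_zero :: 'a \<Rightarrow> 'a \<Rightarrow> 'k})"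

definition FI_strongly_lie_solvable :: "'a::order set \<Rightarrow> 'k::field itself \<Rightarrow> bool" where
  "FI_strongly_lie_solvable X TYPE('k) \<longleftrightarrow> (\<exists>n. strong_lie_derived X n = {fi_zero :: 'a \<Rightarrow> 'a \<Rightarrow> 'k})"

text \<open>A noncommutative polynomial in variables x_0, x_1, ... over K is a finitely
supported function from words (lists of variable indices) to K.\<close>
definition nc_poly :: "(nat list \<Rightarrow> 'k::field) \<Rightarrow> bool" where
  "nc_poly f \<longleftrightarrow> finite {w. f w \<noteq> 0}"

definition fi_word_eval :: "'a::order set \<Rightarrow> (nat \<Rightarrow> ('a \<Rightarrow> 'a \<Rightarrow> 'k::field)) \<Rightarrow> nat list \<Rightarrow> ('a \<Rightarrow> 'a \<Rightarrow> 'k)" where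
  "fi_word_eval X a w = foldr (\<lambda>i acc. fi_mult X (a i) acc) w (fi_one X)"

definition fi_poly_eval :: "'a::order set \<Rightarrow> (nat list \<Rightarrow> 'k::field) \<Rightarrow> (nat \<Rightarrow> ('a \<Rightarrow> 'a \<Rightarrow> 'k)) \<Rightarrow> ('a \<Rightarrow> 'a \<Rightarrow> 'k)" where
  "fi_poly_eval X f a = (\<lambda>x y. \<Sum>w\<in>{w. f w \<noteq> 0}. f w * fi_word_eval X a w x y)"

definition FI_satisfies_PI :: "'a::order set \<Rightarrow> 'k::field itself \<Rightarrow> bool" where
  "FI_satisfies_PI X TYPE('k) \<longleftrightarrow>
     (\<exists>f :: nat list \<Rightarrow> 'k. nc_poly f \<and> f \<noteq> (\<lambda>w. 0) \<and>
        (\<forall>a. (\<forall>i. a i \<in> FI X) \<longrightarrow> fi_poly_eval X f a = fi_zero))"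

definition fi_units :: "'a::order set \<Rightarrow> ('a \<Rightarrow> 'a \<Rightarrow> 'k::field) set" where
  "fi_units X = {\<alpha> \<in> FI X. \<exists>\<beta> \<in> FI X. fi_mult X \<alpha> \<beta> = fi_one X \<and> fi_mult X \<beta> \<alpha> = fi_one X}"

definition FI_units_group :: "'a::order set \<Rightarrow> ('a \<Rightarrow> 'a \<Rightarrow> 'k::field) monoid" where
  "FI_units_group X = \<lparr>carrier = fi_units X, mult = fi_mult X, one = fi_one X\<rparr>"

text \<open>Elements of the free group on generators x_0, x_1, ...: reduced words of letters
(i, inverted?). A nontrivial element is a nonempty reduced word.\<close>
fun reduced_word :: "(nat \<times> bool) list \<Rightarrow> bool" where
  "reduced_word [] = True"
| "reduced_word [_] = True"
| "reduced_word ((i, b) # (j, c) # rest) \<longleftrightarrow> \<not> (i = j \<and> b \<noteq> c) \<and> reduced_word ((j, c) # rest)"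

definition group_word_eval :: "('g, 'm) monoid_scheme \<Rightarrow> (nat \<Rightarrow> 'g) \<Rightarrow> (nat \<times> bool) list \<Rightarrow> 'g" where
  "group_word_eval G g w =
     foldr (\<lambda>(i, b) acc. (if b then inv\<^bsub>G\<^esub> (g i) else g i) \<otimes>\<^bsub>G\<^esub> acc) w \<one>\<^bsub>G\<^esub>"

definition satisfies_group_identity :: "('g, 'm) monoid_scheme \<Rightarrow> bool" where
  "satisfies_group_identity G \<longleftrightarrow>
     (\<exists>w. reduced_word w \<and> w \<noteq> [] \<and>
        (\<forall>g. (\<forall>i. g i \<in> carrier G) \<longrightarrow> group_word_eval G g w = \<one>\<^bsub>G\<^esub>))"

text \<open>l(X) < infinity: lengths |C|-1 of finite chains C in X are bounded.\<close>
definition poset_bounded :: "'a::order set \<Rightarrow> bool" where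
  "poset_bounded X \<longleftrightarrow>
     (\<exists>n::nat. \<forall>C. C \<subseteq> X \<longrightarrow> finite C \<longrightarrow> Complete_Partial_Order.chain (\<le>) C \<longrightarrow> card C \<le> n + 1)"

end

theory Submission
  imports Defs "HOL-Library.Function_Algebras"
begin

text \<open>Let J(n) be the set of series supported on pairs joined by a strict chain of length n. These
are ideals with J(0) = FI(X,K) and [J(n), J(n)] \<subseteq> J(n+1), because diagonals commute, and they vanish
from some n on when X is bounded. Hence both Lie series and the derived series of the units, whose
n-th term lies in 1 + J(n), terminate, and [x_0, x_1]^n is a polynomial identity for large n.

Conversely, let X contain chains of every length. Along a chain c_0 < c_1 < ..., matrix units are
iterated commutators, so no Lie series terminates. For a word w = x_{i_0} ... x_{i_{d-1}}
substitute for x_i the sum N_i of the matrix units e(c_p, c_{p+1}) with i_p = i: then w is the only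
word with a nonzero entry at (c_0, c_d), which excludes polynomial identities. In a group identity
replace each x_i by a product y_i z_i of fresh variables, so that neighbouring letters involve
different variables; then N_i^2 = 0, the units 1 + N_i have inverses 1 - N_i, and the entry at
(c_0, c_d) of the evaluated word is 1 or -1. Over small fields this replaces the Magnus embedding of
the free group.\<close>

section \<open>The algebra of finitary series\<close>

lemma FI_nonzeroD:
  assumes "\<alpha> \<in> FI X" "\<alpha> x y \<noteq> 0"
  shows "x \<in> X" "y \<in> X" "x \<le> y"
  using assms by (auto simp: FI_def fi_elem_def)

text \<open>Removes the condition \<open>x < y\<close> from the finiteness clause: otherwise no pair
  \<open>u < v\<close> fits between \<open>x\<close> and \<open>y\<close>, and the set is
  empty.\<close>

lemma FI_finite_support:
  assumes "\<alpha> \<in> FI X" "x \<in> X" "y \<in> X"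
  shows "finite {(u, v). u \<in> X \<and> v \<in> X \<and> x \<le> u \<and> u < v \<and> v \<le> y \<and> \<alpha> u v \<noteq> 0}"
proof (cases "x < y")
  case True
  then show ?thesis using assms by (auto simp: FI_def fi_elem_def)
next
  case False
  have "{(u, v). u \<in> X \<and> v \<in> X \<and> x \<le> u \<and> u < v \<and> v \<le> y \<and> \<alpha> u v \<noteq> 0} = {}"
    using False by (auto dest: order.strict_trans1 order.strict_trans2)
  then show ?thesis by (simp only: finite.emptyI)
qed

text \<open>The interval from \<open>x\<close> to \<open>y\<close> may be infinite, so convolutions
  cannot be summed over it. \<open>Z\<close> collects the endpoints of the finitely many
  off-diagonal entries lying in it, for all series of \<open>A\<close> at once. Diagonal entries may
  be infinitely many and are excluded; adding \<open>x\<close> and \<open>y\<close> covers those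
  that matter in a product at \<open>(x, y)\<close>.\<close>

lemma FI_common_support:
  fixes X :: "'a::order set" and A :: "('a \<Rightarrow> 'a \<Rightarrow> 'b::field) set"
  assumes "finite A" "A \<subseteq> FI X" "x \<in> X" "y \<in> X"
  obtains Z where "finite Z" "x \<in> Z" "y \<in> Z"
    "\<And>\<alpha> u v. \<alpha> \<in> A \<Longrightarrow> x \<le> u \<Longrightarrow> v \<le> y \<Longrightarrow> \<alpha> u v \<noteq> 0 \<Longrightarrow> u \<noteq> v \<Longrightarrow> u \<in> Z \<and> v \<in> Z"
proof -
  define S where "S \<alpha> = {(u, v). u \<in> X \<and> v \<in> X \<and> x \<le> u \<and> u < v \<and> v \<le> y \<and> \<alpha> u v \<noteq> 0}" for \<alpha> :: "'a \<Rightarrow> 'a \<Rightarrow> 'b"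
  have fin: "finite (S \<alpha>)" if "\<alpha> \<in> A" for \<alpha>
    unfolding S_def using FI_finite_support that assms by blast
  define Z where "Z = {x, y} \<union> (\<Union>\<alpha>\<in>A. fst ` S \<alpha> \<union> snd ` S \<alpha>)"
  show thesis
  proof
    show "finite Z" using fin assms(1) by (simp add: Z_def)
    show "x \<in> Z" "y \<in> Z" by (simp_all add: Z_def)
    show "u \<in> Z \<and> v \<in> Z"
      if "\<alpha> \<in> A" "x \<le> u" "v \<le> y" "\<alpha> u v \<noteq> 0" "u \<noteq> v" for \<alpha> u v
    proof -
      have "(u, v) \<in> S \<alpha>"
        using that assms(2) FI_nonzeroD[of \<alpha> X u v] by (auto simp: S_def)
      then show ?thesis using that(1) unfolding Z_def by force
    qed
  qed
qed

text \<open>The index set in \<open>fi_mult\<close> depends on both factors. Any finite superset of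
  the nonzero summands serves as well, so that different products can be compared over one common
  \<open>Z\<close>. Outside the pairs \<open>x \<le> y\<close> of \<open>X\<close> every summand
  vanishes.\<close>

lemma fi_mult_eq_sum:
  assumes "\<alpha> \<in> FI X" "\<beta> \<in> FI X" "finite Z" "\<And>z. \<alpha> x z * \<beta> z y \<noteq> 0 \<Longrightarrow> z \<in> Z"
  shows "fi_mult X \<alpha> \<beta> x y = (\<Sum>z\<in>Z. \<alpha> x z * \<beta> z y)"
proof (cases "x \<in> X \<and> y \<in> X \<and> x \<le> y")
  case True
  have "(\<Sum>z\<in>{z \<in> X. x \<le> z \<and> z \<le> y \<and> \<alpha> x z * \<beta> z y \<noteq> 0}. \<alpha> x z * \<beta> z y) = (\<Sum>z\<in>Z. \<alpha> x z * \<beta> z y)"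
  proof (rule sum.mono_neutral_left)
    show "{z \<in> X. x \<le> z \<and> z \<le> y \<and> \<alpha> x z * \<beta> z y \<noteq> 0} \<subseteq> Z" using assms(4) by auto
    show "\<forall>z\<in>Z - {z \<in> X. x \<le> z \<and> z \<le> y \<and> \<alpha> x z * \<beta> z y \<noteq> 0}. \<alpha> x z * \<beta> z y = 0"
      using FI_nonzeroD[OF assms(1)] FI_nonzeroD[OF assms(2)] by auto
  qed (rule assms(3))
  then show ?thesis using True by (simp add: fi_mult_def)
next
  case False
  have "\<alpha> x z * \<beta> z y = 0" for z
    using False FI_nonzeroD[OF assms(1), of x z] FI_nonzeroD[OF assms(2), of z y]
    by (auto dest: order_trans)
  then have "(\<Sum>z\<in>Z. \<alpha> x z * \<beta> z y) = 0" by (simp only: sum.neutral_const)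
  then show ?thesis using False by (auto simp: fi_mult_def)
qed

lemma fi_mult_eq_term:
  assumes "\<alpha> \<in> FI X" "\<beta> \<in> FI X" "\<And>z. \<alpha> x z * \<beta> z y \<noteq> 0 \<Longrightarrow> z = w"
  shows "fi_mult X \<alpha> \<beta> x y = \<alpha> x w * \<beta> w y"
  using fi_mult_eq_sum[OF assms(1,2), of "{w}" x y] assms(3) by simp

lemma fi_mult_nonzeroD:
  assumes "fi_mult X \<alpha> \<beta> x y \<noteq> 0"
  shows "x \<in> X" "y \<in> X" "x \<le> y"
    "\<exists>z\<in>X. x \<le> z \<and> z \<le> y \<and> \<alpha> x z \<noteq> 0 \<and> \<beta> z y \<noteq> 0"
proof -
  show "x \<in> X" "y \<in> X" "x \<le> y" using assms by (auto simp: fi_mult_def split: if_splits)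
  show "\<exists>z\<in>X. x \<le> z \<and> z \<le> y \<and> \<alpha> x z \<noteq> 0 \<and> \<beta> z y \<noteq> 0"
  proof (rule ccontr)
    assume "\<not> ?thesis"
    then have "{z \<in> X. x \<le> z \<and> z \<le> y \<and> \<alpha> x z * \<beta> z y \<noteq> 0} = {}" by auto
    then have "fi_mult X \<alpha> \<beta> x y = 0" by (simp only: fi_mult_def) simp
    then show False using assms by simp
  qed
qed

lemma FI_I:
  assumes "\<And>x y. \<alpha> x y \<noteq> 0 \<Longrightarrow> x \<in> X \<and> y \<in> X \<and> x \<le> y"
    and "\<And>x y. x \<in> X \<Longrightarrow> y \<in> X \<Longrightarrow> \<exists>S. finite S \<and>
      (\<forall>u v. x \<le> u \<longrightarrow> u < v \<longrightarrow> v \<le> y \<longrightarrow> \<alpha> u v \<noteq> 0 \<longrightarrow> (u, v) \<in> S)"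
  shows "\<alpha> \<in> FI X"
proof -
  have "finite {(u, v). u \<in> X \<and> v \<in> X \<and> x \<le> u \<and> u < v \<and> v \<le> y \<and> \<alpha> u v \<noteq> 0}"
    if "x \<in> X" "y \<in> X" for x y
  proof -
    obtain S where S: "finite S" "\<forall>u v. x \<le> u \<longrightarrow> u < v \<longrightarrow> v \<le> y \<longrightarrow> \<alpha> u v \<noteq> 0 \<longrightarrow> (u, v) \<in> S"
      using assms(2)[OF \<open>x \<in> X\<close> \<open>y \<in> X\<close>] by auto
    show ?thesis by (rule finite_subset[OF _ S(1)]) (use S(2) in auto)
  qed
  then show ?thesis using assms(1) by (simp add: FI_def fi_elem_def)
qed

text \<open>A nonzero entry at \<open>(u, v)\<close> with \<open>u < v\<close> arises from a middle
  point \<open>z\<close>. If \<open>z\<close> is \<open>u\<close> or \<open>v\<close>, one factor is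
  nonzero at \<open>(u, v)\<close>; otherwise \<open>(u, z)\<close> and \<open>(z, v)\<close> are
  off-diagonal entries of the factors. Either way \<open>u\<close> and \<open>v\<close> lie in the
  finite set \<open>Z\<close>.\<close>

lemma fi_mult_closed:
  assumes "\<alpha> \<in> FI X" "\<beta> \<in> FI X"
  shows "fi_mult X \<alpha> \<beta> \<in> FI X"
proof (rule FI_I)
  show "x \<in> X \<and> y \<in> X \<and> x \<le> y" if "fi_mult X \<alpha> \<beta> x y \<noteq> 0" for x y
    using fi_mult_nonzeroD[OF that] by auto
next
  fix x y assume "x \<in> X" "y \<in> X"
  obtain Z where Z: "finite Z" "x \<in> Z" "y \<in> Z"
    "\<And>\<gamma> u v. \<gamma> \<in> {\<alpha>, \<beta>} \<Longrightarrow> x \<le> u \<Longrightarrow> v \<le> y \<Longrightarrow> \<gamma> u v \<noteq> 0 \<Longrightarrow> u \<noteq> v \<Longrightarrow> u \<in> Z \<and> v \<in> Z"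
    by (rule FI_common_support[of "{\<alpha>, \<beta>}" X x y]) (use assms \<open>x \<in> X\<close> \<open>y \<in> X\<close> in auto)
  have "u \<in> Z \<and> v \<in> Z" if uv: "x \<le> u" "u < v" "v \<le> y" "fi_mult X \<alpha> \<beta> u v \<noteq> 0" for u v
  proof -
    obtain z where z: "u \<le> z" "z \<le> v" "\<alpha> u z \<noteq> 0" "\<beta> z v \<noteq> 0"
      using fi_mult_nonzeroD(4)[OF uv(4)] by auto
    show ?thesis
    proof (cases "u = z \<or> z = v")
      case True
      then show ?thesis using Z(4)[of \<alpha> u v] Z(4)[of \<beta> u v] z uv by auto
    next
      case False
      then show ?thesis using Z(4)[of \<alpha> u z] Z(4)[of \<beta> z v] z uv
        by (auto dest: order_trans)
    qed
  qed
  then show "\<exists>S. finite S \<and> (\<forall>u v. x \<le> u \<longrightarrow> u < v \<longrightarrow> v \<le> y \<longrightarrow> fi_mult X \<alpha> \<beta> u v \<noteq> 0 \<longrightarrow> (u, v) \<in> S)"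
    using Z(1) by (intro exI[of _ "Z \<times> Z"]) auto
qed

lemma FI_zero: "fi_zero \<in> FI X"
  by (simp add: FI_def fi_elem_def fi_zero_def)

lemma FI_one: "fi_one X \<in> FI X"
  by (rule FI_I) (auto simp: fi_one_def split: if_splits)

lemma FI_add:
  assumes "\<alpha> \<in> FI X" "\<beta> \<in> FI X"
  shows "\<alpha> + \<beta> \<in> FI X"
proof (rule FI_I)
  show "x \<in> X \<and> y \<in> X \<and> x \<le> y" if "(\<alpha> + \<beta>) x y \<noteq> 0" for x y
    using that FI_nonzeroD[OF assms(1), of x y] FI_nonzeroD[OF assms(2), of x y] by fastforce
next
  fix x y assume "x \<in> X" "y \<in> X"
  obtain Z where Z: "finite Z" "x \<in> Z" "y \<in> Z"
    "\<And>\<gamma> u v. \<gamma> \<in> {\<alpha>, \<beta>} \<Longrightarrow> x \<le> u \<Longrightarrow> v \<le> y \<Longrightarrow> \<gamma> u v \<noteq> 0 \<Longrightarrow> u \<noteq> v \<Longrightarrow> u \<in> Z \<and> v \<in> Z"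
    by (rule FI_common_support[of "{\<alpha>, \<beta>}" X x y]) (use assms \<open>x \<in> X\<close> \<open>y \<in> X\<close> in auto)
  have "u \<in> Z \<and> v \<in> Z" if uv: "x \<le> u" "u < v" "v \<le> y" "(\<alpha> + \<beta>) u v \<noteq> 0" for u v
    using Z(4)[of \<alpha> u v] Z(4)[of \<beta> u v] uv by fastforce
  then show "\<exists>S. finite S \<and> (\<forall>u v. x \<le> u \<longrightarrow> u < v \<longrightarrow> v \<le> y \<longrightarrow> (\<alpha> + \<beta>) u v \<noteq> 0 \<longrightarrow> (u, v) \<in> S)"
    using Z(1) by (intro exI[of _ "Z \<times> Z"]) auto
qed

lemma FI_scale:
  assumes "\<alpha> \<in> FI X"
  shows "(\<lambda>x y. c * \<alpha> x y) \<in> FI X"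
proof (rule FI_I)
  show "x \<in> X \<and> y \<in> X \<and> x \<le> y" if "c * \<alpha> x y \<noteq> 0" for x y
    using that FI_nonzeroD[OF assms, of x y] by simp
next
  fix x y assume "x \<in> X" "y \<in> X"
  then show "\<exists>S. finite S \<and> (\<forall>u v. x \<le> u \<longrightarrow> u < v \<longrightarrow> v \<le> y \<longrightarrow> c * \<alpha> u v \<noteq> 0 \<longrightarrow> (u, v) \<in> S)"
    using FI_finite_support[OF assms, of x y] FI_nonzeroD[OF assms]
    by (intro exI[of _ "{(u, v). u \<in> X \<and> v \<in> X \<and> x \<le> u \<and> u < v \<and> v \<le> y \<and> \<alpha> u v \<noteq> 0}"]) auto
qed

lemma FI_finite_support_I:
  assumes "\<And>x y. \<alpha> x y \<noteq> 0 \<Longrightarrow> x \<in> X \<and> y \<in> X \<and> x \<le> y"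
    and "finite S" "\<And>x y. \<alpha> x y \<noteq> 0 \<Longrightarrow> (x, y) \<in> S"
  shows "\<alpha> \<in> FI X"
  by (rule FI_I) (use assms in auto)

lemma FI_uminus: "\<alpha> \<in> FI X \<Longrightarrow> - \<alpha> \<in> FI X"
  using FI_scale[of \<alpha> X "-1"] by (simp add: fun_Compl_def)

lemma FI_diff: "\<alpha> \<in> FI X \<Longrightarrow> \<beta> \<in> FI X \<Longrightarrow> \<alpha> - \<beta> \<in> FI X"
  using FI_add[of \<alpha> X "- \<beta>"] FI_uminus[of \<beta> X] by simp

lemma fi_mult_one_left:
  assumes "\<alpha> \<in> FI X"
  shows "fi_mult X (fi_one X) \<alpha> = \<alpha>"
proof (intro ext)
  fix x y
  have "fi_mult X (fi_one X) \<alpha> x y = fi_one X x x * \<alpha> x y"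
    by (rule fi_mult_eq_term[OF FI_one assms]) (auto simp: fi_one_def split: if_splits)
  then show "fi_mult X (fi_one X) \<alpha> x y = \<alpha> x y"
    using FI_nonzeroD[OF assms, of x y] by (auto simp: fi_one_def)
qed

lemma fi_mult_one_right:
  assumes "\<alpha> \<in> FI X"
  shows "fi_mult X \<alpha> (fi_one X) = \<alpha>"
proof (intro ext)
  fix x y
  have "fi_mult X \<alpha> (fi_one X) x y = \<alpha> x y * fi_one X y y"
    by (rule fi_mult_eq_term[OF assms FI_one]) (auto simp: fi_one_def split: if_splits)
  then show "fi_mult X \<alpha> (fi_one X) x y = \<alpha> x y"
    using FI_nonzeroD[OF assms, of x y] by (auto simp: fi_one_def)
qed

text \<open>With \<open>Z\<close> common to the three factors, both bracketings become the same
  double sum over \<open>Z\<close>, up to the order of summation.\<close>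

lemma fi_mult_assoc:
  assumes "\<alpha> \<in> FI X" "\<beta> \<in> FI X" "\<gamma> \<in> FI X"
  shows "fi_mult X (fi_mult X \<alpha> \<beta>) \<gamma> = fi_mult X \<alpha> (fi_mult X \<beta> \<gamma>)"
proof (intro ext)
  fix x y
  show "fi_mult X (fi_mult X \<alpha> \<beta>) \<gamma> x y = fi_mult X \<alpha> (fi_mult X \<beta> \<gamma>) x y"
  proof (cases "x \<in> X \<and> y \<in> X")
    case True
    obtain Z where Z: "finite Z" "x \<in> Z" "y \<in> Z"
      "\<And>\<delta> u v. \<delta> \<in> {\<alpha>, \<beta>, \<gamma>} \<Longrightarrow> x \<le> u \<Longrightarrow> v \<le> y \<Longrightarrow> \<delta> u v \<noteq> 0 \<Longrightarrow> u \<noteq> v \<Longrightarrow> u \<in> Z \<and> v \<in> Z"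
      by (rule FI_common_support[of "{\<alpha>, \<beta>, \<gamma>}" X x y]) (use assms True in auto)
    have "fi_mult X (fi_mult X \<alpha> \<beta>) \<gamma> x y = (\<Sum>z\<in>Z. fi_mult X \<alpha> \<beta> x z * \<gamma> z y)"
    proof (rule fi_mult_eq_sum[OF fi_mult_closed[OF assms(1,2)] assms(3) Z(1)])
      fix z assume nz: "fi_mult X \<alpha> \<beta> x z * \<gamma> z y \<noteq> 0"
      then have "x \<le> z" using fi_mult_nonzeroD(3)[of X \<alpha> \<beta> x z] by auto
      then show "z \<in> Z" using Z(3) Z(4)[of \<gamma> z y] nz by (cases "z = y") auto
    qed
    also have "\<dots> = (\<Sum>z\<in>Z. \<Sum>w\<in>Z. \<alpha> x w * \<beta> w z * \<gamma> z y)"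
    proof (rule sum.cong[OF refl])
      fix z assume "z \<in> Z"
      show "fi_mult X \<alpha> \<beta> x z * \<gamma> z y = (\<Sum>w\<in>Z. \<alpha> x w * \<beta> w z * \<gamma> z y)"
      \<comment> \<open>The inner product at \<open>(x, z)\<close> is a sum over \<open>Z\<close>
        only if \<open>z \<le> y\<close>, which a nonzero \<open>\<gamma> z y\<close> guarantees; if
        that entry is zero, both sides vanish.\<close>
      proof (cases "\<gamma> z y = 0")
        case False
        then have "z \<le> y" using FI_nonzeroD[OF assms(3)] by auto
        have "fi_mult X \<alpha> \<beta> x z = (\<Sum>w\<in>Z. \<alpha> x w * \<beta> w z)"
        proof (rule fi_mult_eq_sum[OF assms(1,2) Z(1)])
          fix w assume nz: "\<alpha> x w * \<beta> w z \<noteq> 0"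
          then have "w \<le> y" using \<open>z \<le> y\<close> FI_nonzeroD[OF assms(2), of w z] by auto
          then show "w \<in> Z" using Z(2) Z(4)[of \<alpha> x w] nz by (cases "w = x") auto
        qed
        then show ?thesis by (simp add: sum_distrib_right)
      qed simp
    qed
    also have "\<dots> = (\<Sum>w\<in>Z. \<Sum>z\<in>Z. \<alpha> x w * \<beta> w z * \<gamma> z y)"
      by (rule sum.swap)
    also have "\<dots> = (\<Sum>w\<in>Z. \<alpha> x w * fi_mult X \<beta> \<gamma> w y)"
    proof (rule sum.cong[OF refl])
      fix w assume "w \<in> Z"
      show "(\<Sum>z\<in>Z. \<alpha> x w * \<beta> w z * \<gamma> z y) = \<alpha> x w * fi_mult X \<beta> \<gamma> w y"
      proof (cases "\<alpha> x w = 0")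
        case False
        then have "x \<le> w" using FI_nonzeroD[OF assms(1)] by auto
        have "fi_mult X \<beta> \<gamma> w y = (\<Sum>z\<in>Z. \<beta> w z * \<gamma> z y)"
        proof (rule fi_mult_eq_sum[OF assms(2,3) Z(1)])
          fix z assume nz: "\<beta> w z * \<gamma> z y \<noteq> 0"
          then have "x \<le> z" using \<open>x \<le> w\<close> FI_nonzeroD[OF assms(2), of w z] by auto
          then show "z \<in> Z" using Z(3) Z(4)[of \<gamma> z y] nz by (cases "z = y") auto
        qed
        then show ?thesis by (simp add: sum_distrib_left mult.assoc)
      qed simp
    qed
    also have "\<dots> = fi_mult X \<alpha> (fi_mult X \<beta> \<gamma>) x y"
    proof (rule fi_mult_eq_sum[OF assms(1) fi_mult_closed[OF assms(2,3)] Z(1), symmetric])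
      fix w assume nz: "\<alpha> x w * fi_mult X \<beta> \<gamma> w y \<noteq> 0"
      then have "w \<le> y" using fi_mult_nonzeroD(3)[of X \<beta> \<gamma> w y] by auto
      then show "w \<in> Z" using Z(2) Z(4)[of \<alpha> x w] nz by (cases "w = x") auto
    qed
    finally show ?thesis .
  next
    case False
    then show ?thesis by (auto simp: fi_mult_def)
  qed
qed

text \<open>The support of \<open>\<gamma>\<close> alone bounds the middle points, so one
  \<open>Z\<close> serves all three products.\<close>

lemma fi_mult_add_left:
  assumes "\<alpha> \<in> FI X" "\<beta> \<in> FI X" "\<gamma> \<in> FI X"
  shows "fi_mult X (\<alpha> + \<beta>) \<gamma> = fi_mult X \<alpha> \<gamma> + fi_mult X \<beta> \<gamma>"
proof (intro ext)
  fix x y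
  show "fi_mult X (\<alpha> + \<beta>) \<gamma> x y = (fi_mult X \<alpha> \<gamma> + fi_mult X \<beta> \<gamma>) x y"
  proof (cases "x \<in> X \<and> y \<in> X")
    case True
    obtain Z where Z: "finite Z" "x \<in> Z" "y \<in> Z"
      "\<And>\<delta> u v. \<delta> \<in> {\<gamma>} \<Longrightarrow> x \<le> u \<Longrightarrow> v \<le> y \<Longrightarrow> \<delta> u v \<noteq> 0 \<Longrightarrow> u \<noteq> v \<Longrightarrow> u \<in> Z \<and> v \<in> Z"
      by (rule FI_common_support[of "{\<gamma>}" X x y]) (use assms True in auto)
    have *: "fi_mult X \<delta> \<gamma> x y = (\<Sum>z\<in>Z. \<delta> x z * \<gamma> z y)" if "\<delta> \<in> FI X" for \<delta>
    proof (rule fi_mult_eq_sum[OF that assms(3) Z(1)])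
      fix z assume nz: "\<delta> x z * \<gamma> z y \<noteq> 0"
      then have "x \<le> z" using FI_nonzeroD[OF that, of x z] by auto
      then show "z \<in> Z" using Z(3) Z(4)[of \<gamma> z y] nz by (cases "z = y") auto
    qed
    show ?thesis
      by (simp add: * FI_add assms distrib_right sum.distrib)
  qed (auto simp: fi_mult_def)
qed

lemma fi_mult_add_right:
  assumes "\<alpha> \<in> FI X" "\<beta> \<in> FI X" "\<gamma> \<in> FI X"
  shows "fi_mult X \<gamma> (\<alpha> + \<beta>) = fi_mult X \<gamma> \<alpha> + fi_mult X \<gamma> \<beta>"
proof (intro ext)
  fix x y
  show "fi_mult X \<gamma> (\<alpha> + \<beta>) x y = (fi_mult X \<gamma> \<alpha> + fi_mult X \<gamma> \<beta>) x y"
  proof (cases "x \<in> X \<and> y \<in> X")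
    case True
    obtain Z where Z: "finite Z" "x \<in> Z" "y \<in> Z"
      "\<And>\<delta> u v. \<delta> \<in> {\<gamma>} \<Longrightarrow> x \<le> u \<Longrightarrow> v \<le> y \<Longrightarrow> \<delta> u v \<noteq> 0 \<Longrightarrow> u \<noteq> v \<Longrightarrow> u \<in> Z \<and> v \<in> Z"
      by (rule FI_common_support[of "{\<gamma>}" X x y]) (use assms True in auto)
    have *: "fi_mult X \<gamma> \<delta> x y = (\<Sum>z\<in>Z. \<gamma> x z * \<delta> z y)" if "\<delta> \<in> FI X" for \<delta>
    proof (rule fi_mult_eq_sum[OF assms(3) that Z(1)])
      fix z assume nz: "\<gamma> x z * \<delta> z y \<noteq> 0"
      then have "z \<le> y" using FI_nonzeroD[OF that, of z y] by auto
      then show "z \<in> Z" using Z(2) Z(4)[of \<gamma> x z] nz by (cases "z = x") auto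
    qed
    show ?thesis
      by (simp add: * FI_add assms distrib_left sum.distrib)
  qed (auto simp: fi_mult_def)
qed

text \<open>For nonzero \<open>c\<close> both sums run over the same index set. For
  \<open>c = 0\<close> the index set on the left is empty, hence the case split.\<close>

lemma fi_mult_scale_right:
  "fi_mult X \<gamma> (\<lambda>x y. c * \<alpha> x y) = (\<lambda>x y. c * fi_mult X \<gamma> \<alpha> x y)"
  by (cases "c = 0") (auto simp: fi_mult_def fun_eq_iff sum_distrib_left mult.left_commute
      intro!: sum.cong)

lemma fi_mult_diff_left:
  assumes "\<alpha> \<in> FI X" "\<beta> \<in> FI X" "\<gamma> \<in> FI X"
  shows "fi_mult X (\<alpha> - \<beta>) \<gamma> = fi_mult X \<alpha> \<gamma> - fi_mult X \<beta> \<gamma>"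
  using fi_mult_add_left[OF FI_diff[OF assms(1,2)] assms(2,3)] by (simp add: algebra_simps)

lemma fi_mult_diff_right:
  assumes "\<alpha> \<in> FI X" "\<beta> \<in> FI X" "\<gamma> \<in> FI X"
  shows "fi_mult X \<gamma> (\<alpha> - \<beta>) = fi_mult X \<gamma> \<alpha> - fi_mult X \<gamma> \<beta>"
  using fi_mult_add_right[OF FI_diff[OF assms(1,2)] assms(2,3)] by (simp add: algebra_simps)

lemma fi_commutator_eq: "fi_commutator X \<alpha> \<beta> = fi_mult X \<alpha> \<beta> - fi_mult X \<beta> \<alpha>"
  by (simp add: fi_commutator_def fun_eq_iff)

text \<open>Stated for an arbitrary subspace \<open>J\<close>, since it is applied both to
  \<open>FI X\<close> and to the terms of the filtration.\<close>

lemma sum_closed_lincomb: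
  fixes J :: "('a \<Rightarrow> 'a \<Rightarrow> 'k::field) set"
  assumes "finite F"
    and zero: "fi_zero \<in> J"
    and add: "\<And>\<alpha> \<beta>. \<alpha> \<in> J \<Longrightarrow> \<beta> \<in> J \<Longrightarrow> \<alpha> + \<beta> \<in> J"
    and scale: "\<And>c \<alpha>. \<alpha> \<in> J \<Longrightarrow> (\<lambda>x y. c * \<alpha> x y) \<in> J"
    and "\<And>v. v \<in> F \<Longrightarrow> B v \<in> J"
  shows "(\<lambda>x y. \<Sum>v\<in>F. c v * B v x y) \<in> J"
  using assms(1,5)
proof (induction F rule: finite_induct)
  case empty
  then show ?case using zero by (simp add: fi_zero_def)
next
  case (insert v F)
  have "(\<lambda>x y. c v * B v x y) + (\<lambda>x y. \<Sum>v\<in>F. c v * B v x y) \<in> J"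
    using insert by (intro add scale) auto
  then show ?case using insert.hyps by (simp add: plus_fun_def)
qed

lemma fi_mult_sum_right:
  fixes X :: "'a::order set" and B :: "'c \<Rightarrow> 'a \<Rightarrow> 'a \<Rightarrow> 'b::field"
  assumes "finite S" "\<gamma> \<in> FI X" "\<And>v. v \<in> S \<Longrightarrow> B v \<in> FI X"
  shows "fi_mult X \<gamma> (\<lambda>x y. \<Sum>v\<in>S. c v * B v x y) = (\<lambda>x y. \<Sum>v\<in>S. c v * fi_mult X \<gamma> (B v) x y)"
  using assms(1,3)
proof (induction S rule: finite_induct)
  case empty
  then show ?case by (simp add: fi_mult_def fun_eq_iff)
next
  case (insert v S)
  \<comment> \<open>General in \<open>D\<close>, as it splits the sum of the \<open>B v\<close> as
    well as the sum of their products with \<open>\<gamma>\<close>.\<close>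
  have *: "(\<lambda>x y. \<Sum>v\<in>insert v S. c v * D v x y) = (\<lambda>x y. c v * D v x y) + (\<lambda>x y. \<Sum>v\<in>S. c v * D v x y)"
    for D :: "'c \<Rightarrow> 'a \<Rightarrow> 'a \<Rightarrow> 'b"
    using insert.hyps by (simp add: fun_eq_iff)
  have "(\<lambda>x y. \<Sum>v\<in>S. c v * B v x y) \<in> FI X"
    using insert by (intro sum_closed_lincomb FI_zero FI_add FI_scale) auto
  then show ?case
    using insert assms(2) by (simp only: * fi_mult_add_right FI_scale fi_mult_scale_right insert_iff simp_thms)
qed

section \<open>The chain length filtration\<close>

text \<open>For n > 0 the chain need not be saturated, and its last element may lie strictly below y.\<close>

fun has_steps :: "'a::order set \<Rightarrow> nat \<Rightarrow> 'a \<Rightarrow> 'a \<Rightarrow> bool" where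
  "has_steps X 0 x y \<longleftrightarrow> x \<in> X \<and> y \<in> X \<and> x \<le> y"
| "has_steps X (Suc n) x y \<longleftrightarrow> x \<in> X \<and> (\<exists>z. x < z \<and> has_steps X n z y)"

lemma has_steps_in: "has_steps X n x y \<Longrightarrow> x \<in> X \<and> y \<in> X \<and> x \<le> y"
  by (induction n arbitrary: x) (auto intro: order.trans less_imp_le)

lemma has_steps_le_trans:
  "x \<in> X \<Longrightarrow> x \<le> z \<Longrightarrow> has_steps X n z y \<Longrightarrow> has_steps X n x y"
  by (cases n) (auto intro: order.trans dest: order.strict_trans1)

lemma has_steps_trans:
  "has_steps X n x z \<Longrightarrow> has_steps X m z y \<Longrightarrow> has_steps X (n + m) x y"
  by (induction n arbitrary: x) (auto intro: has_steps_le_trans)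

lemma has_steps_mono:
  assumes "has_steps X n x y" "m \<le> n"
  shows "has_steps X m x y"
  using assms
proof (induction n arbitrary: m x)
  case (Suc n)
  obtain z where z: "x \<in> X" "x < z" "has_steps X n z y" using Suc.prems by auto
  show ?case
  proof (cases m)
    case 0
    then show ?thesis using has_steps_in[OF Suc.prems(1)] by simp
  next
    case (Suc k)
    then show ?thesis using Suc.IH[OF z(3), of k] z Suc.prems by auto
  qed
qed simp

text \<open>The last conjunct strengthens the induction: it puts the next point strictly below the
  whole chain, so inserting it raises the cardinality by one.\<close>

lemma has_steps_chain:
  assumes "has_steps X n x y"
  shows "\<exists>C. C \<subseteq> X \<and> finite C \<and> Complete_Partial_Order.chain (\<le>) C \<and> card C = n + 1 \<and> (\<forall>c\<in>C. x \<le> c)"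
  using assms
proof (induction n arbitrary: x)
  case 0
  then show ?case by (intro exI[of _ "{x}"]) (auto simp: chain_def)
next
  case (Suc n)
  obtain z where z: "x \<in> X" "x < z" "has_steps X n z y" using Suc.prems by auto
  obtain C where C: "C \<subseteq> X" "finite C" "Complete_Partial_Order.chain (\<le>) C" "card C = n + 1" "\<forall>c\<in>C. z \<le> c"
    using Suc.IH[OF z(3)] by blast
  have lt: "x < c" if "c \<in> C" for c using that C(5) z(2) by (auto dest: order.strict_trans2)
  then have "x \<notin> C" by blast
  then have "card (insert x C) = Suc n + 1" using C by simp
  moreover have "Complete_Partial_Order.chain (\<le>) (insert x C)"
    using C(3) lt by (auto simp: chain_def intro: less_imp_le)
  ultimately show ?case using C z lt by (intro exI[of _ "insert x C"]) (auto intro: less_imp_le)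
qed

text \<open>The ideals J(n).\<close>

definition fi_filtration :: "'a::order set \<Rightarrow> nat \<Rightarrow> ('a \<Rightarrow> 'a \<Rightarrow> 'k::field) set" where
  "fi_filtration X n = {\<alpha> \<in> FI X. \<forall>x y. \<alpha> x y \<noteq> 0 \<longrightarrow> has_steps X n x y}"

lemma fi_filtration_0: "fi_filtration X 0 = FI X"
  by (auto simp: fi_filtration_def dest: FI_nonzeroD)

lemma fi_filtration_FI: "\<alpha> \<in> fi_filtration X n \<Longrightarrow> \<alpha> \<in> FI X"
  by (simp add: fi_filtration_def)

lemma fi_filtration_zero: "fi_zero \<in> fi_filtration X n"
  using FI_zero by (auto simp: fi_filtration_def fi_zero_def)

lemma fi_filtration_add:
  "\<alpha> \<in> fi_filtration X n \<Longrightarrow> \<beta> \<in> fi_filtration X n \<Longrightarrow> \<alpha> + \<beta> \<in> fi_filtration X n"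
  by (auto simp: fi_filtration_def FI_add) (metis add.right_neutral)

lemma fi_filtration_scale:
  "\<alpha> \<in> fi_filtration X n \<Longrightarrow> (\<lambda>x y. c * \<alpha> x y) \<in> fi_filtration X n"
  by (auto simp: fi_filtration_def FI_scale)

lemma fi_filtration_uminus: "\<alpha> \<in> fi_filtration X n \<Longrightarrow> - \<alpha> \<in> fi_filtration X n"
  by (auto simp: fi_filtration_def FI_uminus)

lemma fi_filtration_diff:
  "\<alpha> \<in> fi_filtration X n \<Longrightarrow> \<beta> \<in> fi_filtration X n \<Longrightarrow> \<alpha> - \<beta> \<in> fi_filtration X n"
  using fi_filtration_add[of \<alpha> X n "- \<beta>"] fi_filtration_uminus[of \<beta> X n] by simp

lemma fi_filtration_mult:
  assumes "\<alpha> \<in> fi_filtration X n" "\<beta> \<in> fi_filtration X m"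
  shows "fi_mult X \<alpha> \<beta> \<in> fi_filtration X (n + m)"
proof -
  have "has_steps X (n + m) x y" if nz: "fi_mult X \<alpha> \<beta> x y \<noteq> 0" for x y
  proof -
    obtain z where "\<alpha> x z \<noteq> 0" "\<beta> z y \<noteq> 0" using fi_mult_nonzeroD(4)[OF nz] by auto
    then show ?thesis using assms by (intro has_steps_trans[of X n x z]) (auto simp: fi_filtration_def)
  qed
  then show ?thesis using assms by (simp add: fi_filtration_def fi_mult_closed)
qed

lemma fi_filtration_mult_FI:
  assumes "\<alpha> \<in> fi_filtration X n" "\<beta> \<in> FI X"
  shows "fi_mult X \<alpha> \<beta> \<in> fi_filtration X n" "fi_mult X \<beta> \<alpha> \<in> fi_filtration X n"
  using fi_filtration_mult[of \<alpha> X n \<beta> 0] fi_filtration_mult[of \<beta> X 0 \<alpha> n] assms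
  by (simp_all add: fi_filtration_0)

lemma fi_filtration_antimono: "m \<le> n \<Longrightarrow> fi_filtration X n \<subseteq> fi_filtration X m"
  by (auto simp: fi_filtration_def intro: has_steps_mono)

text \<open>For \<open>n = 0\<close> the diagonal of a product is the product of the diagonals, and
  these commute because the coefficients lie in a field; so the commutator has zero diagonal. For
  \<open>n > 0\<close> both products already lie in the term of index \<open>n + n\<close>, which is
  at least \<open>Suc n\<close>.\<close>

lemma fi_filtration_commutator:
  fixes X :: "'a::order set" and \<alpha> :: "'a \<Rightarrow> 'a \<Rightarrow> 'k::field"
  assumes "\<alpha> \<in> fi_filtration X n" "\<beta> \<in> fi_filtration X n"
  shows "fi_commutator X \<alpha> \<beta> \<in> fi_filtration X (Suc n)"
proof (cases n)
  case 0
  have FI: "\<alpha> \<in> FI X" "\<beta> \<in> FI X" using assms fi_filtration_FI by auto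
  have diag: "fi_mult X \<gamma> \<delta> x x = \<gamma> x x * \<delta> x x" if "\<gamma> \<in> FI X" "\<delta> \<in> FI X" for \<gamma> \<delta> :: "'a \<Rightarrow> 'a \<Rightarrow> 'k" and x
    using FI_nonzeroD[OF that(1)] FI_nonzeroD[OF that(2)]
    by (intro fi_mult_eq_term that) (auto intro: order.antisym)
  have C: "fi_commutator X \<alpha> \<beta> \<in> FI X"
    unfolding fi_commutator_eq by (intro FI_diff fi_mult_closed FI)
  have "has_steps X 1 x y" if "fi_commutator X \<alpha> \<beta> x y \<noteq> 0" for x y
  proof -
    have "x \<noteq> y" using that diag FI by (auto simp: fi_commutator_def mult.commute)
    then show ?thesis using FI_nonzeroD[OF C that] by (auto intro!: exI[of _ y])
  qed
  then show ?thesis using C 0 by (simp add: fi_filtration_def)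
next
  case (Suc k)
  have "fi_commutator X \<alpha> \<beta> \<in> fi_filtration X (n + n)"
    unfolding fi_commutator_eq using assms by (intro fi_filtration_diff fi_filtration_mult)
  then show ?thesis using fi_filtration_antimono[of "Suc n" "n + n" X] Suc by auto
qed

lemma fi_span_filtration:
  assumes "S \<subseteq> fi_filtration X n"
  shows "fi_span S \<subseteq> fi_filtration X n"
  using assms
  by (auto simp: fi_span_def intro!: sum_closed_lincomb fi_filtration_zero fi_filtration_add fi_filtration_scale)

lemma fi_filtration_bounded:
  fixes X :: "'a::order set"
  assumes "poset_bounded X"
  obtains n where "fi_filtration X n = {fi_zero :: 'a \<Rightarrow> 'a \<Rightarrow> 'k::field}"
proof -
  obtain n where n: "\<And>C. C \<subseteq> X \<Longrightarrow> finite C \<Longrightarrow> Complete_Partial_Order.chain (\<le>) C \<Longrightarrow> card C \<le> n + 1"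
    using assms unfolding poset_bounded_def by blast
  \<comment> \<open>Such a pair would yield a chain with \<open>n + 2\<close> elements.\<close>
  have "\<not> has_steps X (n + 1) x y" for x y
    using has_steps_chain[of X "n + 1" x y] n by fastforce
  then have "\<alpha> x y = 0" if "\<alpha> \<in> fi_filtration X (n + 1)" for \<alpha> :: "'a \<Rightarrow> 'a \<Rightarrow> 'k" and x y
    using that unfolding fi_filtration_def by blast
  then have "fi_filtration X (n + 1) \<subseteq> {fi_zero :: 'a \<Rightarrow> 'a \<Rightarrow> 'k::field}"
    by (auto simp: fi_zero_def fun_eq_iff)
  then show thesis using fi_filtration_zero[of X "n + 1"] that by blast
qed


section \<open>Bounded posets: Lie series and a polynomial identity\<close>

lemma fi_lie_bracket_space_filtration:
  assumes "U \<subseteq> fi_filtration X n"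
  shows "fi_lie_bracket_space X U U \<subseteq> fi_filtration X (Suc n)"
  unfolding fi_lie_bracket_space_def
  by (rule fi_span_filtration) (use assms in \<open>auto intro!: fi_filtration_commutator\<close>)

lemma lie_derived_filtration: "lie_derived X n \<subseteq> fi_filtration X n"
  by (induction n) (simp_all add: fi_filtration_0 fi_lie_bracket_space_filtration)

lemma strong_lie_derived_filtration: "strong_lie_derived X n \<subseteq> fi_filtration X n"
proof (induction n)
  case (Suc n)
  show ?case
    unfolding strong_lie_derived.simps fi_prod_space_def
    using fi_lie_bracket_space_filtration[OF Suc]
    by (intro fi_span_filtration) (auto intro!: fi_filtration_mult_FI(1))
qed (simp add: fi_filtration_0)

lemma fi_span_zero: "fi_zero \<in> fi_span S"
  by (auto simp: fi_span_def fi_zero_def intro!: exI[of _ "{}"])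

lemma fi_span_superset: "\<alpha> \<in> S \<Longrightarrow> \<alpha> \<in> fi_span S"
  unfolding fi_span_def by (auto intro!: exI[of _ "{\<alpha>}"] exI[of _ "\<lambda>_. 1"])

lemma bounded_imp_lie_solvable:
  fixes X :: "'a::order set"
  assumes "poset_bounded X"
  shows "FI_lie_solvable X TYPE('k::field)" "FI_strongly_lie_solvable X TYPE('k)"
proof -
  obtain n where n: "fi_filtration X n = {fi_zero :: 'a \<Rightarrow> 'a \<Rightarrow> 'k}"
    using fi_filtration_bounded[OF assms] .
  \<comment> \<open>Solvability asks for equality with the zero space, so zero must be exhibited: it
    lies in \<open>FI X\<close>, and it is the empty sum in every later term.\<close>
  have "fi_zero \<in> lie_derived X n" "fi_zero \<in> strong_lie_derived X n"
    by (cases n; simp add: FI_zero fi_lie_bracket_space_def fi_prod_space_def fi_span_zero)+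
  then have "lie_derived X n = {fi_zero :: 'a \<Rightarrow> 'a \<Rightarrow> 'k}"
    "strong_lie_derived X n = {fi_zero :: 'a \<Rightarrow> 'a \<Rightarrow> 'k}"
    using lie_derived_filtration[of X n] strong_lie_derived_filtration[of X n] n by blast+
  then show "FI_lie_solvable X TYPE('k)" "FI_strongly_lie_solvable X TYPE('k)"
    by (auto simp: FI_lie_solvable_def FI_strongly_lie_solvable_def)
qed

text \<open>The coefficients of [x_0, x_1]^n.\<close>

fun comm_power_poly :: "nat \<Rightarrow> nat list \<Rightarrow> 'k::field" where
  "comm_power_poly 0 w = (if w = [] then 1 else 0)"
| "comm_power_poly (Suc n) w = (case w of
      a # b # v \<Rightarrow> (if a = 0 \<and> b = 1 then comm_power_poly n v
                  else if a = 1 \<and> b = 0 then - comm_power_poly n v else 0)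
    | _ \<Rightarrow> 0)"

lemma comm_power_poly_support_Suc:
  "{w. comm_power_poly (Suc n) w \<noteq> (0::'k::field)} =
     (\<lambda>v. 0 # 1 # v) ` {w. comm_power_poly n w \<noteq> (0::'k)} \<union> (\<lambda>v. 1 # 0 # v) ` {w. comm_power_poly n w \<noteq> (0::'k)}"
proof (intro Set.set_eqI)
  fix w :: "nat list"
  show "w \<in> {w. comm_power_poly (Suc n) w \<noteq> (0::'k)} \<longleftrightarrow>
    w \<in> (\<lambda>v. 0 # 1 # v) ` {w. comm_power_poly n w \<noteq> (0::'k)} \<union> (\<lambda>v. 1 # 0 # v) ` {w. comm_power_poly n w \<noteq> (0::'k)}"
    by (cases w; cases "tl w") (auto simp: image_iff)
qed

lemma comm_power_poly_finite: "finite {w. comm_power_poly n w \<noteq> (0::'k::field)}"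
proof (induction n)
  case 0
  have "{w. comm_power_poly 0 w \<noteq> (0::'k)} \<subseteq> {[]}" by auto
  then show ?case by (rule finite_subset) simp
next
  case (Suc n)
  then show ?case unfolding comm_power_poly_support_Suc by simp
qed

lemma comm_power_poly_nonzero: "\<exists>w. comm_power_poly n w \<noteq> (0::'k::field)"
proof (induction n)
  case (Suc n)
  then obtain w where "comm_power_poly n w \<noteq> (0::'k)" by blast
  then show ?case by (intro exI[of _ "0 # 1 # w"]) simp
qed (auto intro: exI[of _ "[]"])

lemma fi_word_eval_closed:
  assumes "\<And>i. a i \<in> FI X"
  shows "fi_word_eval X a w \<in> FI X"
  by (induction w) (auto simp: fi_word_eval_def FI_one fi_mult_closed assms)

text \<open>The words in the support begin with 0 1 or with 1 0. For a fixed remainder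
  \<open>v\<close> the two words have opposite coefficients, so together they contribute the
  commutator times the value of \<open>v\<close>.\<close>

lemma comm_power_poly_eval_Suc:
  assumes "\<And>i. a i \<in> FI X"
  shows "fi_poly_eval X (comm_power_poly (Suc n)) a =
    fi_mult X (fi_commutator X (a 0) (a 1)) (fi_poly_eval X (comm_power_poly n) a)"
proof (intro ext)
  fix x y
  let ?S = "{w. comm_power_poly n w \<noteq> (0::'b)}"
  let ?e = "fi_word_eval X a"
  have e: "?e v \<in> FI X" for v by (rule fi_word_eval_closed[OF assms])
  have fin: "finite ?S" by (rule comm_power_poly_finite)
  have "fi_poly_eval X (comm_power_poly (Suc n)) a x y =
      (\<Sum>w\<in>(\<lambda>v. 0 # 1 # v) ` ?S. comm_power_poly (Suc n) w * ?e w x y) +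
      (\<Sum>w\<in>(\<lambda>v. 1 # 0 # v) ` ?S. comm_power_poly (Suc n) w * ?e w x y)"
    unfolding fi_poly_eval_def comm_power_poly_support_Suc using fin
    by (intro sum.union_disjoint) auto
  also have "\<dots> = (\<Sum>v\<in>?S. comm_power_poly n v * ?e (0 # 1 # v) x y) +
      (\<Sum>v\<in>?S. - comm_power_poly n v * ?e (1 # 0 # v) x y)"
    by (subst (1 2) sum.reindex) (auto simp: inj_on_def)
  also have "\<dots> = (\<Sum>v\<in>?S. comm_power_poly n v * (?e (0 # 1 # v) x y - ?e (1 # 0 # v) x y))"
    by (simp add: sum.distrib[symmetric] right_diff_distrib)
  also have "\<dots> = (\<Sum>v\<in>?S. comm_power_poly n v * fi_mult X (fi_commutator X (a 0) (a 1)) (?e v) x y)"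
  proof -
    have "?e (0 # 1 # v) = fi_mult X (fi_mult X (a 0) (a 1)) (?e v)"
         "?e (1 # 0 # v) = fi_mult X (fi_mult X (a 1) (a 0)) (?e v)" for v
      by (simp_all add: fi_mult_assoc assms e) (simp_all add: fi_word_eval_def)
    then show ?thesis
      by (simp add: fi_commutator_eq fi_mult_diff_left fi_mult_closed assms e)
  qed
  also have "\<dots> = fi_mult X (fi_commutator X (a 0) (a 1)) (fi_poly_eval X (comm_power_poly n) a) x y"
    unfolding fi_poly_eval_def
    by (subst fi_mult_sum_right[OF fin]) (auto simp: fi_commutator_eq intro!: FI_diff fi_mult_closed assms e)
  finally show "fi_poly_eval X (comm_power_poly (Suc n)) a x y = \<dots>" .
qed

text \<open>Each commutator factor lies in J(1), and the indices add up under
  multiplication.\<close>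

lemma comm_power_poly_eval_filtration:
  assumes "\<And>i. a i \<in> FI X"
  shows "fi_poly_eval X (comm_power_poly n) a \<in> fi_filtration X n"
proof (induction n)
  case 0
  show ?case unfolding fi_filtration_0 fi_poly_eval_def
    by (intro sum_closed_lincomb comm_power_poly_finite FI_zero FI_add FI_scale fi_word_eval_closed assms)
next
  case (Suc n)
  have "fi_commutator X (a 0) (a 1) \<in> fi_filtration X 1"
    using fi_filtration_commutator[of "a 0" X 0 "a 1"] assms by (simp add: fi_filtration_0)
  then show ?case
    using fi_filtration_mult[OF _ Suc, of "fi_commutator X (a 0) (a 1)" 1]
    unfolding comm_power_poly_eval_Suc[OF assms] by simp
qed

lemma bounded_imp_PI:
  fixes X :: "'a::order set"
  assumes "poset_bounded X"
  shows "FI_satisfies_PI X TYPE('k::field)"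
proof -
  obtain n where n: "fi_filtration X n = {fi_zero :: 'a \<Rightarrow> 'a \<Rightarrow> 'k}"
    using fi_filtration_bounded[OF assms] .
  have "fi_poly_eval X (comm_power_poly n) a = fi_zero" if "\<forall>i. a i \<in> FI X" for a :: "nat \<Rightarrow> 'a \<Rightarrow> 'a \<Rightarrow> 'k"
    using comm_power_poly_eval_filtration[of a X n] n that by simp
  moreover have "comm_power_poly n \<noteq> (\<lambda>w. 0 :: 'k)"
    using comm_power_poly_nonzero[of n, where ?'k = 'k] by auto
  ultimately show ?thesis
    unfolding FI_satisfies_PI_def nc_poly_def using comm_power_poly_finite by blast
qed

section \<open>Unbounded posets\<close>

text \<open>A chain of length \<open>n\<close> has \<open>n + 1\<close> points, with indices from 0
  to \<open>n\<close>; the values of \<open>c\<close> beyond \<open>n\<close> are arbitrary.\<close>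

definition strict_chain :: "'a::order set \<Rightarrow> nat \<Rightarrow> (nat \<Rightarrow> 'a) \<Rightarrow> bool" where
  "strict_chain X n c \<longleftrightarrow> (\<forall>i\<le>n. c i \<in> X) \<and> (\<forall>i j. i < j \<longrightarrow> j \<le> n \<longrightarrow> c i < c j)"

lemma strict_chain_eq_iff:
  assumes "strict_chain X n c" "i \<le> n" "j \<le> n"
  shows "c i = c j \<longleftrightarrow> i = j"
  using assms unfolding strict_chain_def by (metis less_irrefl linorder_neqE_nat)

lemma finite_chain_imp_strict_chain:
  assumes "finite C" "Complete_Partial_Order.chain (\<le>) C" "card C = Suc n"
  shows "\<exists>c. strict_chain C n c"
  using assms
proof (induction n arbitrary: C)
  case 0
  then obtain x where "C = {x}" by (metis One_nat_def card_1_singletonE)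
  then show ?case by (auto simp: strict_chain_def)
next
  case (Suc n)
  have "C \<noteq> {}" using Suc.prems by auto
  then obtain m where m: "m \<in> C" "\<And>x. x \<in> C \<Longrightarrow> x \<le> m \<Longrightarrow> m = x"
    using finite_has_minimal[OF Suc.prems(1)] by blast
  \<comment> \<open>In a chain a minimal element is comparable with all others, hence least.\<close>
  have lt: "m < x" if "x \<in> C - {m}" for x
    using that m Suc.prems(2) unfolding chain_def by (metis DiffD1 DiffD2 insertI1 order.not_eq_order_implies_strict)
  have "\<exists>c. strict_chain (C - {m}) n c"
    using Suc.prems m(1) by (intro Suc.IH) (auto simp: chain_def)
  then obtain c where c: "strict_chain (C - {m}) n c" by blast
  \<comment> \<open>\<open>case_nat m c\<close> places \<open>m\<close> at index 0 and moves the
    remaining chain up by one.\<close>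
  have "strict_chain C (Suc n) (case_nat m c)"
    using c m(1) lt by (auto simp: strict_chain_def split: nat.splits)
  then show ?case by blast
qed

lemma unbounded_imp_strict_chain:
  assumes "\<not> poset_bounded X"
  shows "\<exists>c. strict_chain X n c"
proof -
  obtain C where C: "C \<subseteq> X" "finite C" "Complete_Partial_Order.chain (\<le>) C" "\<not> card C \<le> n + 1"
    using assms unfolding poset_bounded_def by blast
  \<comment> \<open>Unboundedness only gives a chain that is too long; it is thinned to exactly
    \<open>n + 1\<close> points.\<close>
  obtain D where D: "D \<subseteq> C" "card D = Suc n" 
    using C(4) obtain_subset_with_card_n[of "Suc n" C] by auto
  have "finite D" using D(1) C(2) finite_subset by blast
  moreover have "Complete_Partial_Order.chain (\<le>) D" using C(3) D(1) by (auto simp: chain_def)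
  ultimately obtain c where "strict_chain D n c" using finite_chain_imp_strict_chain D(2) by blast
  then show ?thesis using D(1) C(1) unfolding strict_chain_def by blast
qed

section \<open>Matrix units and shifts along a chain\<close>

definition matrix_unit :: "'a \<Rightarrow> 'a \<Rightarrow> 'a \<Rightarrow> 'a \<Rightarrow> 'k::field" where
  "matrix_unit x y = (\<lambda>u v. if u = x \<and> v = y then 1 else 0)"

lemma matrix_unit_FI: "x \<in> X \<Longrightarrow> y \<in> X \<Longrightarrow> x \<le> y \<Longrightarrow> matrix_unit x y \<in> FI X"
  by (rule FI_finite_support_I[of _ _ "{(x, y)}"]) (auto simp: matrix_unit_def split: if_splits)

text \<open>The product in the given order is the matrix unit at \<open>(x, y)\<close>; the product
  in the reverse order vanishes because \<open>x \<noteq> y\<close>.\<close>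

lemma matrix_unit_commutator:
  assumes "x \<in> X" "z \<in> X" "y \<in> X" "x < z" "z < y"
  shows "fi_commutator X (matrix_unit x z) (matrix_unit z y) = (matrix_unit x y :: 'a::order \<Rightarrow> 'a \<Rightarrow> 'k::field)"
proof (intro ext)
  fix u v
  have FI: "matrix_unit x z \<in> FI X" "(matrix_unit z y :: 'a \<Rightarrow> 'a \<Rightarrow> 'k) \<in> FI X"
    using assms by (auto intro!: matrix_unit_FI)
  have "fi_mult X (matrix_unit x z) (matrix_unit z y) u v = (matrix_unit x z u z * matrix_unit z y z v :: 'k)"
    by (rule fi_mult_eq_term[OF FI]) (auto simp: matrix_unit_def split: if_splits)
  moreover have "fi_mult X (matrix_unit z y) (matrix_unit x z) u v = (matrix_unit z y u y * matrix_unit x z y v :: 'k)"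
    by (rule fi_mult_eq_term[OF FI(2,1)]) (auto simp: matrix_unit_def split: if_splits)
  moreover have "x \<noteq> y" using assms by auto
  ultimately show "fi_commutator X (matrix_unit x z) (matrix_unit z y) u v = (matrix_unit x y u v :: 'k)"
    by (auto simp: fi_commutator_def matrix_unit_def)
qed

text \<open>Each bracket joins two adjacent intervals of the chain, so a gap of \<open>2 ^ n\<close>
  suffices for the n-th term of both series.\<close>

lemma matrix_unit_derived:
  assumes c: "strict_chain X m c" and "i + 2 ^ n \<le> j" "j \<le> m"
  shows "(matrix_unit (c i) (c j) :: 'a::order \<Rightarrow> 'a \<Rightarrow> 'k::field) \<in> lie_derived X n \<inter> strong_lie_derived X n"
  using assms(2,3)
proof (induction n arbitrary: i j)
  case 0
  then show ?case using c by (auto simp: strict_chain_def intro!: matrix_unit_FI less_imp_le)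
next
  case (Suc n)
  \<comment> \<open>The cut leaves a gap of exactly \<open>2 ^ n\<close> below and of at least
    \<open>2 ^ n\<close> above.\<close>
  define k where "k = i + 2 ^ n"
  have k: "k + 2 ^ n \<le> j" "k \<le> m" "i < k" "k < j" "i \<le> m"
    using Suc.prems zero_less_power[of "2::nat" n] unfolding k_def power_Suc by linarith+
  let ?M = "\<lambda>i j. matrix_unit (c i) (c j) :: 'a \<Rightarrow> 'a \<Rightarrow> 'k"
  have comm: "?M i j = fi_commutator X (?M i k) (?M k j)"
    using c k Suc.prems(2) by (intro matrix_unit_commutator[symmetric]) (auto simp: strict_chain_def)
  have IH: "?M i k \<in> lie_derived X n \<inter> strong_lie_derived X n" "?M k j \<in> lie_derived X n \<inter> strong_lie_derived X n"
    using Suc.IH[of i k] Suc.IH[of k j] k Suc.prems(2) by (auto simp: k_def)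
  have "?M i j \<in> lie_derived X (Suc n)"
    using IH comm by (auto simp: fi_lie_bracket_space_def intro!: fi_span_superset)
  moreover have "?M i j \<in> fi_lie_bracket_space X (strong_lie_derived X n) (strong_lie_derived X n)"
    using IH comm by (auto simp: fi_lie_bracket_space_def intro!: fi_span_superset)
  moreover have "?M i j \<in> FI X"
    using c k Suc.prems(2) by (intro matrix_unit_FI) (auto simp: strict_chain_def less_imp_le)
  \<comment> \<open>Multiplying by the identity places the bracket itself in the product space of
    the strong series.\<close>
  then have "fi_mult X (?M i j) (fi_one X) = ?M i j" by (rule fi_mult_one_right)
  ultimately have "?M i j \<in> strong_lie_derived X (Suc n)"
    unfolding strong_lie_derived.simps fi_prod_space_def
    by (intro fi_span_superset) (use FI_one[of X] in force)
  with \<open>?M i j \<in> lie_derived X (Suc n)\<close> show ?case by blast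
qed

lemma lie_solvable_imp_bounded:
  fixes X :: "'a::order set"
  assumes "FI_lie_solvable X TYPE('k::field) \<or> FI_strongly_lie_solvable X TYPE('k)"
  shows "poset_bounded X"
proof (rule ccontr)
  assume "\<not> poset_bounded X"
  obtain n where n: "lie_derived X n = {fi_zero :: 'a \<Rightarrow> 'a \<Rightarrow> 'k} \<or> strong_lie_derived X n = {fi_zero :: 'a \<Rightarrow> 'a \<Rightarrow> 'k}"
    using assms by (auto simp: FI_lie_solvable_def FI_strongly_lie_solvable_def)
  obtain c where c: "strict_chain X (2 ^ n) c"
    using unbounded_imp_strict_chain[OF \<open>\<not> poset_bounded X\<close>] by blast
  have "matrix_unit (c 0) (c (2 ^ n)) = (fi_zero :: 'a \<Rightarrow> 'a \<Rightarrow> 'k)"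
    using matrix_unit_derived[OF c, of 0 n "2 ^ n"] n by auto
  then have "matrix_unit (c 0) (c (2 ^ n)) (c 0) (c (2 ^ n)) = (0 :: 'k)"
    by (simp add: fi_zero_def)
  then show False by (simp add: matrix_unit_def)
qed

text \<open>Along a strict chain this is the sum of the matrix units at
  \<open>(c p, c (Suc p))\<close> over the \<open>p < n\<close> with \<open>P p\<close>. If
  \<open>P p\<close> says that the letter at position \<open>p\<close> involves the variable
  \<open>i\<close>, it is the element N_i.\<close>

definition chain_shift :: "(nat \<Rightarrow> 'a) \<Rightarrow> nat \<Rightarrow> (nat \<Rightarrow> bool) \<Rightarrow> 'a \<Rightarrow> 'a \<Rightarrow> 'k::field" where
  "chain_shift c n P = (\<lambda>x y. if \<exists>p<n. P p \<and> x = c p \<and> y = c (Suc p) then 1 else 0)"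

lemma chain_shift_FI:
  assumes "strict_chain X n c"
  shows "chain_shift c n P \<in> FI X"
  by (rule FI_finite_support_I[of _ _ "(\<lambda>p. (c p, c (Suc p))) ` {..<n}"])
    (use assms in \<open>auto simp: chain_shift_def strict_chain_def less_imp_le split: if_splits\<close>)

lemma chain_shift_at:
  assumes "strict_chain X n c" "j \<le> n"
  shows "chain_shift c n P (c j) y = (if j < n \<and> P j \<and> y = c (Suc j) then 1 else 0)"
proof -
  have "(\<exists>p<n. P p \<and> c j = c p \<and> y = c (Suc p)) \<longleftrightarrow> j < n \<and> P j \<and> y = c (Suc j)"
  proof
    assume "\<exists>p<n. P p \<and> c j = c p \<and> y = c (Suc p)"
    then obtain p where p: "p < n" "P p" "c j = c p" "y = c (Suc p)" by blast
    then have "j = p" using strict_chain_eq_iff[OF assms, of p] by simp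
    with p show "j < n \<and> P j \<and> y = c (Suc j)" by simp
  qed auto
  then show ?thesis by (simp add: chain_shift_def)
qed

text \<open>Row \<open>c j\<close> of the shift has at most one nonzero entry, so multiplying from
  the left moves row \<open>c (Suc j)\<close> of \<open>\<alpha>\<close> to row \<open>c j\<close>,
  or kills it. A product of shifts thus reads a word letter by letter along the chain.\<close>

lemma chain_shift_mult:
  assumes "strict_chain X n c" "j \<le> n" "\<alpha> \<in> FI X"
  shows "fi_mult X (chain_shift c n P) \<alpha> (c j) y = (if j < n \<and> P j then \<alpha> (c (Suc j)) y else 0)"
proof -
  have "fi_mult X (chain_shift c n P) \<alpha> (c j) y = chain_shift c n P (c j) (c (Suc j)) * \<alpha> (c (Suc j)) y"
    by (rule fi_mult_eq_term[OF chain_shift_FI[OF assms(1)] assms(3)])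
      (auto simp: chain_shift_at[OF assms(1,2)] split: if_splits)
  then show ?thesis by (simp add: chain_shift_at[OF assms(1,2)])
qed

text \<open>Starting at an arbitrary \<open>j\<close> makes the induction on \<open>v\<close>
  possible: each letter of \<open>v\<close> must agree with the letter of \<open>w\<close> at the
  current position, and \<open>v\<close> must end exactly where \<open>w\<close> does.\<close>

lemma chain_shift_word_eval:
  fixes X :: "'a::order set"
  assumes c: "strict_chain X (length w) c" and "j \<le> length w"
  shows "fi_word_eval X (\<lambda>i. chain_shift c (length w) (\<lambda>p. w ! p = i)) v (c j) (c (length w)) =
    (if v = drop j w then 1 else (0::'k::field))"
  using assms(2)
proof (induction v arbitrary: j)
  case Nil
  have "c j \<in> X" using c Nil by (simp add: strict_chain_def)
  then show ?case using strict_chain_eq_iff[OF c, of j "length w"] Nil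
    by (auto simp: fi_word_eval_def fi_one_def)
next
  case (Cons i v)
  let ?a = "\<lambda>i. chain_shift c (length w) (\<lambda>p. w ! p = i) :: 'a \<Rightarrow> 'a \<Rightarrow> 'k"
  have "fi_word_eval X ?a (i # v) (c j) (c (length w)) =
      (if j < length w \<and> w ! j = i then fi_word_eval X ?a v (c (Suc j)) (c (length w)) else 0)"
    using chain_shift_mult[OF c Cons.prems fi_word_eval_closed[of ?a X v], OF chain_shift_FI[OF c]]
    by (simp add: fi_word_eval_def)
  then show ?case
    using Cons.IH[of "Suc j"] Cons.prems
    by (cases "j < length w") (auto simp flip: Cons_nth_drop_Suc)
qed

lemma PI_imp_bounded:
  fixes X :: "'a::order set"
  assumes "FI_satisfies_PI X TYPE('k::field)"
  shows "poset_bounded X"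
proof (rule ccontr)
  assume "\<not> poset_bounded X"
  obtain f :: "nat list \<Rightarrow> 'k" where f: "finite {w. f w \<noteq> 0}" "f \<noteq> (\<lambda>w. 0)"
    "\<And>a. (\<And>i. a i \<in> FI X) \<Longrightarrow> fi_poly_eval X f a = fi_zero"
    using assms unfolding FI_satisfies_PI_def nc_poly_def by blast
  obtain w where w: "f w \<noteq> 0" using f(2) by auto
  obtain c where c: "strict_chain X (length w) c"
    using unbounded_imp_strict_chain[OF \<open>\<not> poset_bounded X\<close>] by blast
  let ?a = "\<lambda>i. chain_shift c (length w) (\<lambda>p. w ! p = i) :: 'a \<Rightarrow> 'a \<Rightarrow> 'k"
  have "0 = fi_poly_eval X f ?a (c 0) (c (length w))"
    using f(3)[of ?a, OF chain_shift_FI[OF c]] by (simp add: fi_zero_def)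
  \<comment> \<open>At this entry every word other than \<open>w\<close> evaluates to zero, so only
    the coefficient of \<open>w\<close> survives.\<close>
  also have "\<dots> = (\<Sum>v\<in>{v. f v \<noteq> 0}. if v = w then f w else 0)"
    unfolding fi_poly_eval_def chain_shift_word_eval[OF c le0] by (intro sum.cong) auto
  also have "\<dots> = f w" using f(1) w by simp
  finally show False using w by simp
qed

section \<open>Group identities\<close>

text \<open>Reducedness is a condition on neighbouring letters; in this form the library rules for
  \<open>successively\<close> under append, map and reversal apply.\<close>

lemma reduced_word_iff_successively:
  "reduced_word w \<longleftrightarrow> successively (\<lambda>p q. \<not> (fst p = fst q \<and> snd p \<noteq> snd q)) w"
  by (induction w rule: reduced_word.induct) auto

lemma group_word_eval_Nil: "group_word_eval G g [] = \<one>\<^bsub>G\<^esub>"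
  by (simp add: group_word_eval_def)

lemma group_word_eval_Cons:
  "group_word_eval G g ((i, b) # w) = (if b then inv\<^bsub>G\<^esub> (g i) else g i) \<otimes>\<^bsub>G\<^esub> group_word_eval G g w"
  by (simp add: group_word_eval_def)

section \<open>Solvable groups and iterated commutator words\<close>

definition inverse_word :: "(nat \<times> bool) list \<Rightarrow> (nat \<times> bool) list" where
  "inverse_word w = rev (map (\<lambda>(i, b). (i, \<not> b)) w)"

context group
begin

lemma group_word_eval_closed:
  assumes "\<And>i. g i \<in> carrier G"
  shows "group_word_eval G g w \<in> carrier G"
  by (induction w) (auto simp: group_word_eval_Nil group_word_eval_Cons assms)

lemma group_word_eval_append:
  assumes "\<And>i. g i \<in> carrier G"
  shows "group_word_eval G g (u @ v) = group_word_eval G g u \<otimes> group_word_eval G g v"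
  by (induction u)
    (auto simp: group_word_eval_Nil group_word_eval_Cons assms group_word_eval_closed m_assoc)

lemma group_word_eval_inverse:
  assumes "\<And>i. g i \<in> carrier G"
  shows "group_word_eval G g (inverse_word w) = inv (group_word_eval G g w)"
  by (induction w)
    (auto simp: inverse_word_def group_word_eval_Nil group_word_eval_Cons group_word_eval_append
      assms group_word_eval_closed inv_mult_group)

end

text \<open>Disjoint sets of variables in the two halves keep the iterated commutators reduced.\<close>

fun derived_word :: "nat \<Rightarrow> nat \<Rightarrow> (nat \<times> bool) list" where
  "derived_word 0 k = [(k, False)]"
| "derived_word (Suc n) k =
     derived_word n k @ derived_word n (k + 2 ^ n) @
     inverse_word (derived_word n k) @ inverse_word (derived_word n (k + 2 ^ n))"

lemma derived_word_nonempty: "derived_word n k \<noteq> []"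
  by (induction n arbitrary: k) auto

lemma inverse_word_vars: "fst ` set (inverse_word w) = fst ` set w"
  by (simp add: inverse_word_def image_image case_prod_beta)

lemma derived_word_vars: "fst ` set (derived_word n k) \<subseteq> {k..<k + 2 ^ n}"
proof (induction n arbitrary: k)
  case (Suc n)
  have "fst ` set (derived_word (Suc n) k) = fst ` set (derived_word n k) \<union> fst ` set (derived_word n (k + 2 ^ n))"
    by (auto simp only: derived_word.simps set_append image_Un inverse_word_vars)
  also have "\<dots> \<subseteq> {k..<k + 2 ^ Suc n}"
    using Suc.IH[of k] Suc.IH[of "k + 2 ^ n"] by fastforce
  finally show ?case .
qed simp

text \<open>The forbidden relation between neighbours is symmetric and unaffected by flipping both
  signs.\<close>

lemma reduced_word_inverse: "reduced_word w \<Longrightarrow> reduced_word (inverse_word w)"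
  unfolding reduced_word_iff_successively inverse_word_def
  by (auto simp: successively_map case_prod_beta elim!: successively_mono)

lemma reduced_word_append:
  assumes "reduced_word u" "reduced_word v" "u \<noteq> []" "v \<noteq> []" "fst (last u) \<noteq> fst (hd v)"
  shows "reduced_word (u @ v)"
  using assms unfolding reduced_word_iff_successively by (simp add: successively_append_iff)

text \<open>Each of the four blocks is reduced, and at each of the three junctions a letter of one
  half meets a letter of the other, with a different variable; inverting a block does not change its
  variables.\<close>

lemma derived_word_reduced: "reduced_word (derived_word n k)"
proof (induction n arbitrary: k)
  case (Suc n)
  define u v where "u = derived_word n k" and "v = derived_word n (k + 2 ^ n)"
  have ne: "u \<noteq> []" "v \<noteq> []" "inverse_word u \<noteq> []" "inverse_word v \<noteq> []"
    by (simp_all add: u_def v_def derived_word_nonempty inverse_word_def)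
  have "fst ` set u \<inter> fst ` set v = {}"
    using derived_word_vars[of n k] derived_word_vars[of n "k + 2 ^ n"] unfolding u_def v_def by fastforce
  then have disj: "fst p \<noteq> fst q" if "p \<in> set u \<union> set (inverse_word u)" "q \<in> set v \<union> set (inverse_word v)" for p q
    using that inverse_word_vars[of u] inverse_word_vars[of v] by (metis UnE disjoint_iff imageI)
  have red: "reduced_word u" "reduced_word v" "reduced_word (inverse_word u)" "reduced_word (inverse_word v)"
    using Suc.IH by (simp_all add: u_def v_def reduced_word_inverse)
  have "reduced_word (inverse_word u @ inverse_word v)"
    using red ne disj[of "last (inverse_word u)" "hd (inverse_word v)"]
    by - (rule reduced_word_append; simp)
  then have "reduced_word (v @ inverse_word u @ inverse_word v)"
    using red ne disj[of "hd (inverse_word u)" "last v"]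
    by - (rule reduced_word_append; simp)
  then have "reduced_word (u @ v @ inverse_word u @ inverse_word v)"
    using red ne disj[of "last u" "hd v"]
    by - (rule reduced_word_append; simp)
  then show ?case by (simp add: u_def v_def)
qed simp

text \<open>The word of level \<open>Suc n\<close> evaluates to the group commutator of two values
  of level \<open>n\<close>, and the derived subgroup is generated by such commutators.\<close>

lemma (in group) derived_word_eval:
  assumes "\<And>i. g i \<in> carrier G"
  shows "group_word_eval G g (derived_word n k) \<in> (derived G ^^ n) (carrier G)"
proof (induction n arbitrary: k)
  case 0
  then show ?case using assms by (simp add: group_word_eval_Nil group_word_eval_Cons)
next
  case (Suc n)
  let ?u = "group_word_eval G g (derived_word n k)"
  let ?v = "group_word_eval G g (derived_word n (k + 2 ^ n))"
  have "group_word_eval G g (derived_word (Suc n) k) = ?u \<otimes> ?v \<otimes> inv ?u \<otimes> inv ?v"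
    by (simp add: group_word_eval_append group_word_eval_inverse group_word_eval_closed assms m_assoc)
  also have "\<dots> \<in> derived_set G ((derived G ^^ n) (carrier G))"
    using Suc.IH by blast
  also have "\<dots> \<subseteq> (derived G ^^ Suc n) (carrier G)"
    unfolding funpow.simps comp_apply derived_def[of G "(derived G ^^ n) (carrier G)"] by (blast intro: generate.incl)
  finally show ?case .
qed

lemma (in group) solvable_imp_group_identity:
  assumes "solvable G"
  shows "satisfies_group_identity G"
proof -
  obtain n where n: "(derived G ^^ n) (carrier G) = {\<one>}"
    using assms solvable_iff_trivial_derived_seq by blast
  show ?thesis
    unfolding satisfies_group_identity_def
    using derived_word_reduced[of n 0] derived_word_nonempty[of n 0] derived_word_eval[of _ n 0] n by auto
qed

text \<open>Substituting y_i z_i for x_i, with y_i and z_i the variables 2i and 2i+1.\<close>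

definition doubled_word :: "(nat \<times> bool) list \<Rightarrow> (nat \<times> bool) list" where
  "doubled_word w = concat (map (\<lambda>(i, b).
     if b then [(2 * i + 1, True), (2 * i, True)] else [(2 * i, False), (2 * i + 1, False)]) w)"

text \<open>Inside a block the variables differ by one. At a junction, letters of equal sign
  contribute variables of opposite parity; letters of opposite sign contribute variables of the same
  parity, which differ because reducedness forces \<open>i \<noteq> j\<close>.\<close>

lemma doubled_word_alternating:
  "reduced_word w \<Longrightarrow> successively (\<lambda>p q. fst p \<noteq> fst q) (doubled_word w)"
proof (induction w rule: reduced_word.induct)
  case (2 p)
  then show ?case by (cases p) (auto simp: doubled_word_def)
next
  case (3 i b j c w)
  have "2 * i \<noteq> Suc (2 * j)" "Suc (2 * i) \<noteq> 2 * j" by presburger+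
  with 3 show ?case by (cases b; cases c) (auto simp: doubled_word_def)
qed (simp add: doubled_word_def)

lemma (in group) doubled_word_eval:
  assumes "\<And>i. g i \<in> carrier G"
  shows "group_word_eval G g (doubled_word w) = group_word_eval G (\<lambda>i. g (2 * i) \<otimes> g (2 * i + 1)) w"
proof (induction w)
  case (Cons p w)
  obtain i b where p: "p = (i, b)" by fastforce
  have "group_word_eval G g (doubled_word (p # w)) =
    (if b then inv (g (2 * i) \<otimes> g (2 * i + 1)) else g (2 * i) \<otimes> g (2 * i + 1)) \<otimes>
      group_word_eval G g (doubled_word w)"
    using assms group_word_eval_closed[of g, OF assms]
    by (auto simp: p doubled_word_def group_word_eval_Cons inv_mult_group m_assoc)
  then show ?case using Cons.IH by (simp add: p group_word_eval_Cons)
qed (simp add: doubled_word_def group_word_eval_Nil)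

text \<open>A reduced word may repeat a letter; an identity without such repetitions is what later
  makes the substituted elements square to zero.\<close>

lemma (in group) group_identity_alternating:
  assumes "satisfies_group_identity G"
  obtains w where "successively (\<lambda>p q. fst p \<noteq> fst q) w" "w \<noteq> []"
    "\<And>g. (\<And>i. g i \<in> carrier G) \<Longrightarrow> group_word_eval G g w = \<one>"
proof -
  obtain w where w: "reduced_word w" "w \<noteq> []"
    "\<And>g. (\<And>i. g i \<in> carrier G) \<Longrightarrow> group_word_eval G g w = \<one>"
    using assms unfolding satisfies_group_identity_def by blast
  show thesis
  proof
    show "successively (\<lambda>p q. fst p \<noteq> fst q) (doubled_word w)"
      by (rule doubled_word_alternating[OF w(1)])
    show "doubled_word w \<noteq> []" 
      using w(2) by (cases w) (auto simp: doubled_word_def split: if_splits)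
    show "group_word_eval G g (doubled_word w) = \<one>" if g: "\<And>i. g i \<in> carrier G" for g
      unfolding doubled_word_eval[OF g] by (rule w(3)) (simp add: g)
  qed
qed

section \<open>The group of units\<close>

lemma FI_units_group: "group (FI_units_group X :: ('a::order \<Rightarrow> 'a \<Rightarrow> 'k::field) monoid)"
proof -
  define M where "M = (\<lparr>carrier = FI X, mult = fi_mult X, one = fi_one X\<rparr> :: ('a \<Rightarrow> 'a \<Rightarrow> 'k) monoid)"
  have "monoid M"
    by (rule monoidI)
      (auto simp: M_def fi_mult_closed FI_one fi_mult_assoc fi_mult_one_left fi_mult_one_right)
  then have "group (units_of M)" by (rule monoid.units_group)
  moreover have "units_of M = FI_units_group X"
    by (auto simp: units_of_def M_def FI_units_group_def fi_units_def Units_def)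
  ultimately show ?thesis by simp
qed

lemma FI_units_inv:
  assumes "\<alpha> \<in> fi_units X"
  shows "inv\<^bsub>FI_units_group X\<^esub> \<alpha> \<in> FI X"
    "fi_mult X \<alpha> (inv\<^bsub>FI_units_group X\<^esub> \<alpha>) = fi_one X"
    "fi_mult X (inv\<^bsub>FI_units_group X\<^esub> \<alpha>) \<alpha> = fi_one X"
    "inv\<^bsub>FI_units_group X\<^esub> \<alpha> \<in> fi_units X"
  using group.inv_closed[OF FI_units_group, of \<alpha> X] group.r_inv[OF FI_units_group, of \<alpha> X]
    group.l_inv[OF FI_units_group, of \<alpha> X] assms
  by (auto simp: FI_units_group_def fi_units_def)

text \<open>The congruence subgroup of units that are 1 modulo J(n).\<close>

definition congruence_units :: "'a::order set \<Rightarrow> nat \<Rightarrow> ('a \<Rightarrow> 'a \<Rightarrow> 'k::field) set" where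
  "congruence_units X n = {\<alpha> \<in> fi_units X. \<alpha> - fi_one X \<in> fi_filtration X n}"

text \<open>Writing a for \<open>\<alpha>\<close> and b for \<open>\<beta>\<close>, closure rests on
  a^-1 - 1 = - a^-1 (a - 1) and ab - 1 = a (b - 1) + (a - 1), as J(n) is an ideal.\<close>

lemma congruence_units_subgroup:
  "subgroup (congruence_units X n :: ('a::order \<Rightarrow> 'a \<Rightarrow> 'k::field) set) (FI_units_group X)"
proof -
  let ?G = "FI_units_group X :: ('a \<Rightarrow> 'a \<Rightarrow> 'k) monoid"
  interpret G: group ?G by (rule FI_units_group)
  have FI: "\<alpha> \<in> FI X" if "\<alpha> \<in> fi_units X" for \<alpha> :: "'a \<Rightarrow> 'a \<Rightarrow> 'k"
    using that by (simp add: fi_units_def)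
  have carrier: "carrier ?G = fi_units X" and mult: "mult ?G = fi_mult X" and one: "one ?G = fi_one X"
    by (simp_all add: FI_units_group_def)
  show ?thesis
  proof (rule G.subgroupI)
    show "congruence_units X n \<subseteq> carrier ?G" by (auto simp: carrier congruence_units_def)
    have "(fi_one X :: 'a \<Rightarrow> 'a \<Rightarrow> 'k) \<in> fi_units X" using G.one_closed by (simp add: carrier one)
    then have "(fi_one X :: 'a \<Rightarrow> 'a \<Rightarrow> 'k) \<in> congruence_units X n"
      using fi_filtration_zero[of X n] by (simp add: congruence_units_def fi_zero_def zero_fun_def)
    then show "(congruence_units X n :: ('a \<Rightarrow> 'a \<Rightarrow> 'k) set) \<noteq> {}" by blast
  next
    fix \<alpha> :: "'a \<Rightarrow> 'a \<Rightarrow> 'k" assume "\<alpha> \<in> congruence_units X n"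
    then have \<alpha>: "\<alpha> \<in> fi_units X" "\<alpha> - fi_one X \<in> fi_filtration X n"
      by (auto simp: congruence_units_def)
    note inv = FI_units_inv[OF \<alpha>(1)]
    have "inv\<^bsub>?G\<^esub> \<alpha> - fi_one X = - fi_mult X (inv\<^bsub>?G\<^esub> \<alpha>) (\<alpha> - fi_one X)"
      by (simp add: fi_mult_diff_right FI[OF \<alpha>(1)] FI_one inv fi_mult_one_right)
    then show "inv\<^bsub>?G\<^esub> \<alpha> \<in> congruence_units X n"
      using inv(1,4) \<alpha>(2) by (simp add: congruence_units_def fi_filtration_uminus fi_filtration_mult_FI(2))
  next
    fix \<alpha> \<beta> :: "'a \<Rightarrow> 'a \<Rightarrow> 'k" assume "\<alpha> \<in> congruence_units X n" "\<beta> \<in> congruence_units X n"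
    then have *: "\<alpha> \<in> fi_units X" "\<alpha> - fi_one X \<in> fi_filtration X n"
        "\<beta> \<in> fi_units X" "\<beta> - fi_one X \<in> fi_filtration X n"
      by (auto simp: congruence_units_def)
    have "fi_mult X \<alpha> \<beta> - fi_one X = fi_mult X \<alpha> (\<beta> - fi_one X) + (\<alpha> - fi_one X)"
      by (simp add: fi_mult_diff_right FI * FI_one fi_mult_one_right)
    moreover have "fi_mult X \<alpha> \<beta> \<in> fi_units X"
      using G.m_closed[of \<alpha> \<beta>] * by (simp add: carrier mult)
    moreover have "fi_mult X \<alpha> (\<beta> - fi_one X) + (\<alpha> - fi_one X) \<in> fi_filtration X n"
      using * by (intro fi_filtration_add fi_filtration_mult_FI(2) FI)
    ultimately show "\<alpha> \<otimes>\<^bsub>?G\<^esub> \<beta> \<in> congruence_units X n"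
      by (simp only: mult congruence_units_def mem_Collect_eq simp_thms)
  qed
qed

text \<open>With a, b for \<open>\<alpha>\<close>, \<open>\<beta>\<close>: a b a^-1 b^-1 - 1 =
  [a, b] a^-1 b^-1, since 1 = (b a)(a^-1 b^-1). Moreover [a, b] = [a - 1, b - 1], since 1 is
  central, and this bracket lies in J(n+1).\<close>

lemma congruence_units_commutator:
  fixes X :: "'a::order set" and \<alpha> \<beta> :: "'a \<Rightarrow> 'a \<Rightarrow> 'k::field"
  defines "G \<equiv> FI_units_group X :: ('a \<Rightarrow> 'a \<Rightarrow> 'k) monoid"
  assumes "\<alpha> \<in> congruence_units X n" "\<beta> \<in> congruence_units X n"
  shows "\<alpha> \<otimes>\<^bsub>G\<^esub> \<beta> \<otimes>\<^bsub>G\<^esub> inv\<^bsub>G\<^esub> \<alpha> \<otimes>\<^bsub>G\<^esub> inv\<^bsub>G\<^esub> \<beta> \<in> congruence_units X (Suc n)"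
proof -
  interpret G: group G unfolding G_def by (rule FI_units_group)
  have carrier: "carrier G = fi_units X" and mult: "mult G = fi_mult X" and one: "one G = fi_one X"
    by (simp_all add: G_def FI_units_group_def)
  have *: "\<alpha> \<in> fi_units X" "\<alpha> - fi_one X \<in> fi_filtration X n"
      "\<beta> \<in> fi_units X" "\<beta> - fi_one X \<in> fi_filtration X n"
    using assms by (auto simp: congruence_units_def)
  have FI: "\<gamma> \<in> FI X" if "\<gamma> \<in> fi_units X" for \<gamma> :: "'a \<Rightarrow> 'a \<Rightarrow> 'k"
    using that by (simp add: fi_units_def)
  let ?a = "inv\<^bsub>G\<^esub> \<alpha>" and ?b = "inv\<^bsub>G\<^esub> \<beta>"
  have inv: "?a \<in> fi_units X" "?b \<in> fi_units X"
    using G.inv_closed *(1,3) by (simp_all add: carrier)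
  have FIs: "\<alpha> \<in> FI X" "\<beta> \<in> FI X" "?a \<in> FI X" "?b \<in> FI X"
    using *(1,3) inv FI by auto
  have "fi_mult X (fi_mult X \<beta> \<alpha>) (fi_mult X ?a ?b) = fi_one X"
  proof -
    have "\<beta> \<otimes>\<^bsub>G\<^esub> \<alpha> \<otimes>\<^bsub>G\<^esub> (?a \<otimes>\<^bsub>G\<^esub> ?b) = \<one>\<^bsub>G\<^esub>"
      using *(1,3) by (metis G.inv_mult_group G.m_closed G.r_inv carrier)
    then show ?thesis by (simp add: mult one)
  qed
  moreover have "fi_mult X (fi_mult X (fi_mult X \<alpha> \<beta>) ?a) ?b = fi_mult X (fi_mult X \<alpha> \<beta>) (fi_mult X ?a ?b)"
    by (intro fi_mult_assoc fi_mult_closed FIs)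
  ultimately have "fi_mult X (fi_mult X (fi_mult X \<alpha> \<beta>) ?a) ?b - fi_one X =
      fi_mult X (fi_commutator X \<alpha> \<beta>) (fi_mult X ?a ?b)"
    by (simp add: fi_commutator_eq fi_mult_diff_left fi_mult_closed FIs)
  moreover have "fi_commutator X \<alpha> \<beta> = fi_commutator X (\<alpha> - fi_one X) (\<beta> - fi_one X)"
    by (simp add: fi_commutator_eq fi_mult_diff_left fi_mult_diff_right FIs FI_one FI_diff
        fi_mult_one_left fi_mult_one_right)
  ultimately have "fi_mult X (fi_mult X (fi_mult X \<alpha> \<beta>) ?a) ?b - fi_one X \<in> fi_filtration X (Suc n)"
    using fi_filtration_commutator[OF *(2,4)] by (simp add: fi_filtration_mult_FI(1) fi_mult_closed FIs)
  moreover have "\<alpha> \<otimes>\<^bsub>G\<^esub> \<beta> \<otimes>\<^bsub>G\<^esub> ?a \<otimes>\<^bsub>G\<^esub> ?b \<in> carrier G"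
    using *(1,3) inv by (simp add: carrier[symmetric])
  ultimately show ?thesis by (simp add: congruence_units_def mult carrier)
qed

lemma bounded_imp_solvable:
  fixes X :: "'a::order set"
  assumes "poset_bounded X"
  shows "solvable (FI_units_group X :: ('a \<Rightarrow> 'a \<Rightarrow> 'k::field) monoid)"
proof -
  let ?G = "FI_units_group X :: ('a \<Rightarrow> 'a \<Rightarrow> 'k) monoid"
  interpret G: group ?G by (rule FI_units_group)
  have sub: "(derived ?G ^^ n) (carrier ?G) \<subseteq> congruence_units X n" for n
  proof (induction n)
    case 0
    show ?case
      by (auto simp: congruence_units_def FI_units_group_def fi_filtration_0 fi_units_def FI_one intro!: FI_diff)
  next
    case (Suc n)
    then show ?case
      unfolding funpow.simps comp_apply derived_def[of _ "(derived ?G ^^ n) (carrier ?G)"]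
      by (intro G.generate_subgroup_incl congruence_units_subgroup) (auto intro!: congruence_units_commutator)
  qed
  obtain n where n: "fi_filtration X n = {fi_zero :: 'a \<Rightarrow> 'a \<Rightarrow> 'k}"
    using fi_filtration_bounded[OF assms] .
  \<comment> \<open>Where J(n) is zero, a unit congruent to 1 is 1.\<close>
  have "congruence_units X n \<subseteq> {\<one>\<^bsub>?G\<^esub>}"
    by (auto simp: congruence_units_def n FI_units_group_def fi_zero_def fun_eq_iff)
  then have "(derived ?G ^^ n) (carrier ?G) = {\<one>\<^bsub>?G\<^esub>}"
    using sub[of n] subgroup.one_closed[OF G.exp_of_derived_is_subgroup[OF G.subgroup_self, of n]] by blast
  then show ?thesis using G.solvable_iff_trivial_derived_seq by blast
qed

lemma group_identity_imp_bounded: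
  fixes X :: "'a::order set"
  assumes "satisfies_group_identity (FI_units_group X :: ('a \<Rightarrow> 'a \<Rightarrow> 'k::field) monoid)"
  shows "poset_bounded X"
proof (rule ccontr)
  assume unbounded: "\<not> poset_bounded X"
  let ?G = "FI_units_group X :: ('a \<Rightarrow> 'a \<Rightarrow> 'k) monoid"
  interpret G: group ?G by (rule FI_units_group)
  obtain w where w: "successively (\<lambda>p q. fst p \<noteq> fst q) w" "w \<noteq> []"
    "\<And>g. (\<And>i. g i \<in> carrier ?G) \<Longrightarrow> group_word_eval ?G g w = \<one>\<^bsub>?G\<^esub>"
    using G.group_identity_alternating[OF assms] by blast
  define D where "D = length w"
  obtain c where c: "strict_chain X D c"
    using unbounded_imp_strict_chain[OF unbounded] by blast
  define N where "N i = (chain_shift c D (\<lambda>p. fst (w ! p) = i) :: 'a \<Rightarrow> 'a \<Rightarrow> 'k)" for i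
  have N: "N i \<in> FI X" for i unfolding N_def by (rule chain_shift_FI[OF c])
  have adj: "fst (w ! p) \<noteq> fst (w ! Suc p)" if "Suc p < D" for p
  proof -
    have "w = take p w @ w ! p # w ! Suc p # drop (Suc (Suc p)) w"
      using that by (simp add: D_def Cons_nth_drop_Suc)
    then have "successively (\<lambda>p q. fst p \<noteq> fst q) (take p w @ w ! p # w ! Suc p # drop (Suc (Suc p)) w)"
      using w(1) by simp
    then show ?thesis by (simp add: successively_append_iff)
  qed
  \<comment> \<open>A nonzero entry would come from two consecutive steps of the chain, hence from
    two neighbouring letters of \<open>w\<close> in the same variable.\<close>
  have NN: "fi_mult X (N i) (N i) = 0" for i
  proof (rule ccontr)
    assume "fi_mult X (N i) (N i) \<noteq> 0"
    then obtain x y where nz: "fi_mult X (N i) (N i) x y \<noteq> 0" by (auto simp: fun_eq_iff)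
    then obtain z where z: "N i x z \<noteq> 0" "N i z y \<noteq> 0" using fi_mult_nonzeroD(4)[OF nz] by blast
    from z(1) obtain p where p: "p < D" "fst (w ! p) = i" "z = c (Suc p)"
      by (auto simp: N_def chain_shift_def split: if_splits)
    then have "Suc p < D \<and> fst (w ! Suc p) = i"
      using z(2) by (auto simp: N_def chain_shift_at[OF c, of "Suc p" _ y] split: if_splits)
    then show False using adj p(2) by blast
  qed
  define g where "g i = fi_one X + N i" for i
  have inverse: "fi_mult X (g i) (fi_one X - N i) = fi_one X" "fi_mult X (fi_one X - N i) (g i) = fi_one X" for i
    by (simp_all add: g_def fi_mult_add_left fi_mult_add_right fi_mult_diff_left fi_mult_diff_right
        FI_one FI_add FI_diff N NN fi_mult_one_left fi_mult_one_right)
  have gFI: "g i \<in> FI X" "fi_one X - N i \<in> FI X" for i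
    by (auto simp: g_def intro: FI_add FI_diff FI_one N)
  have units: "g i \<in> carrier ?G" "fi_one X - N i \<in> carrier ?G" for i
    using inverse[of i] gFI[of i] by (auto simp: FI_units_group_def fi_units_def)
  have inv: "inv\<^bsub>?G\<^esub> (g i) = fi_one X - N i" for i
    using inverse units by (intro G.inv_equality) (simp_all add: FI_units_group_def)
  let ?E = "\<lambda>k. group_word_eval ?G g (drop k w)"
  have E: "?E k \<in> FI X" for k
    using G.group_word_eval_closed[of g, OF units(1)] by (auto simp: FI_units_group_def fi_units_def)
  \<comment> \<open>Descending induction on the start \<open>k\<close> of the suffix. One more
    letter replaces the value E by E + N_i E or E - N_i E. In rows \<open>c j\<close> with
    \<open>j \<le> k\<close> the summand E vanishes by hypothesis, and N_i E takes its entry from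
    row \<open>c (Suc j)\<close>: zero for \<open>j < k\<close>, nonzero for \<open>j = k\<close>,
    where the letter matches.\<close>
  have "(\<forall>j<k. ?E k (c j) (c D) = 0) \<and> ?E k (c k) (c D) \<noteq> 0" if "k \<le> D" for k
    using that
  proof (induction rule: inc_induct)
    case base
    have "c D \<in> X" using c by (simp add: strict_chain_def)
    then show ?case using strict_chain_eq_iff[OF c, of _ D]
      by (auto simp: D_def[symmetric] drop_all group_word_eval_Nil FI_units_group_def fi_one_def)
  next
    case (step k)
    obtain i b where ib: "w ! k = (i, b)" by fastforce
    have "drop k w = (i, b) # drop (Suc k) w"
      using step.hyps(2) by (simp add: D_def ib Cons_nth_drop_Suc[symmetric])
    then have "?E k = (if b then ?E (Suc k) - fi_mult X (N i) (?E (Suc k)) else ?E (Suc k) + fi_mult X (N i) (?E (Suc k)))"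
      by (simp add: group_word_eval_Cons inv)
        (simp add: FI_units_group_def g_def fi_mult_add_left fi_mult_diff_left FI_one N E[unfolded FI_units_group_def] fi_mult_one_left)
    moreover have "fi_mult X (N i) (?E (Suc k)) (c j) (c D) =
        (if fst (w ! j) = i then ?E (Suc k) (c (Suc j)) (c D) else 0)" if "j \<le> k" for j
      using chain_shift_mult[OF c _ E] that step.hyps(2) by (simp add: N_def)
    ultimately show ?case using step.IH ib by auto
  qed
  from this[of 0] have "group_word_eval ?G g w (c 0) (c D) \<noteq> 0" by simp
  moreover have "group_word_eval ?G g w = fi_one X"
    using w(3)[of g, OF units(1)] by (simp add: FI_units_group_def)
  \<comment> \<open>As \<open>w\<close> is nonempty, \<open>D > 0\<close>, so the identity has a
    zero at this entry.\<close>
  moreover have "c 0 \<noteq> c D" using strict_chain_eq_iff[OF c, of 0 D] w(2) by (simp add: D_def)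
  ultimately show False by (simp add: fi_one_def)
qed

theorem theorem1p3:
  fixes X :: "'a::order set"
  shows "(FI_satisfies_PI X TYPE('k::field) \<longleftrightarrow> poset_bounded X)
       \<and> (FI_lie_solvable X TYPE('k) \<longleftrightarrow> poset_bounded X)
       \<and> (FI_strongly_lie_solvable X TYPE('k) \<longleftrightarrow> poset_bounded X)
       \<and> (satisfies_group_identity (FI_units_group X :: ('a \<Rightarrow> 'a \<Rightarrow> 'k) monoid) \<longleftrightarrow> poset_bounded X)
       \<and> (solvable (FI_units_group X :: ('a \<Rightarrow> 'a \<Rightarrow> 'k) monoid) \<longleftrightarrow> poset_bounded X)"
proof -
  let ?G = "FI_units_group X :: ('a \<Rightarrow> 'a \<Rightarrow> 'k) monoid"
  \<comment> \<open>Closes the cycle for the units: bounded, solvable, group identity, bounded. The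
    other conditions are linked to boundedness directly in both directions.\<close>
  have "solvable ?G \<Longrightarrow> satisfies_group_identity ?G"
    by (rule group.solvable_imp_group_identity[OF FI_units_group])
  then show ?thesis
    using bounded_imp_PI[of X, where ?'k = 'k] PI_imp_bounded[of X, where ?'k = 'k]
      bounded_imp_lie_solvable[of X, where ?'k = 'k] lie_solvable_imp_bounded[of X, where ?'k = 'k]
      bounded_imp_solvable[of X, where ?'k = 'k] group_identity_imp_bounded[of X, where ?'k = 'k]
    by blast
qed

end
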